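(* Let $p>0$, $0\le s<p$, $\rho>0$ and $a>0$. Suppose that the samples $Y_1,\dots,Y_n$ from $f_Y$ and $\epsilon_1,\dots,\epsilon_m$ from $f_\epsilon$, $n,m\ge2$, are independent. Denote by $\mathcal{D}_a$ the set of all densities $f_\epsilon\in\mathcal{D}$ which are supersmooth with parameter $a$, i.e. for which there is a constant $d>0$ with $d\le(1+t^2)^a\,|\ln(|[\mathcal{F}f_\epsilon](t)|^2)|^{-1}\le d^{-1}$ for all $t\in\mathbb{R}$. Then there is a constant $C>0$, not depending on $n,m$, such that $$\inf_{\widehat{f_X}}\ \sup_{f_X\in H_p^\rho,\ f_\epsilon\in\mathcal{D}_a}\mathbb{E}\|\widehat{f_X}-f_X\|_s^2\ \ge\ C\big\{(\log n)^{-(p-s)/a}+(\log m)^{-(p-s)/a}\big\}.$$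
   Context: $[\mathcal{F}g](t)=\frac{1}{\sqrt{2\pi}}\int_{-\infty}^\infty e^{-itx}g(x)\,dx$ (extended as a unitary operator to $L^2(\mathbb{R})$). $\mathcal{D}$ is the set of all probability densities in $L^2(\mathbb{R})$. $\|f\|_s^2:=\int_{-\infty}^\infty(1+t^2)^s|[\mathcal{F}f](t)|^2\,dt$, $H_s:=\{f\in L^2(\mathbb{R}):\|f\|_s<\infty\}$ and $H_p^\rho:=\{f\in H_p:\|f\|_p^2\le\rho\}$; in the supremum $f_X$ is a density in $\mathcal{D}$ belonging to $H_p^\rho$. Statistical model: $X$ and $\epsilon$ are independent with unknown densities $f_X,f_\epsilon\in\mathcal{D}$, $|[\mathcal{F}f_\epsilon](t)|^2>0$ for all $t$, and $Y=X+\epsilon$ has density $f_Y=f_X\star f_\epsilon$ (convolution); one observes i.i.d. samples $Y_1,\dots,Y_n$ from $f_Y$ and $\epsilon_1,\dots,\epsilon_m$ from $f_\epsilon$. The infimum is over all estimators $\widehat{f_X}$ of $f_X$ based on these two samples. Both $\ln$ and $\log$ denote the natural logarithm. *)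

theory Defs
  imports "HOL-Probability.Probability"
begin

definition L2 :: "(real \<Rightarrow> complex) set" where
  "L2 = {g \<in> borel_measurable borel. integrable lborel (\<lambda>x. (cmod (g x))\<^sup>2)}"

definition fourier_int :: "(real \<Rightarrow> complex) \<Rightarrow> real \<Rightarrow> complex" where
  "fourier_int g t =
     complex_of_real (1 / sqrt (2 * pi)) * (LINT x|lborel. exp (- \<i> * of_real (t * x)) * g x)"

(* The unitary extension to L2.  An integrable g has the continuous representative given by the
   integral, so pointwise statements about the transform of a density are meaningful.
   For g in L2 - L1 the transform is the L2-limit of the transforms of the truncations of g to
   [-k, k] (which lie in both L1 and L2 and converge to g in L2); it is determined up to a null
   set, and SOME picks a representative. *)
definition fourier :: "(real \<Rightarrow> complex) \<Rightarrow> real \<Rightarrow> complex" where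
  "fourier g =
     (if integrable lborel g then fourier_int g
      else (SOME h. h \<in> L2 \<and>
        (\<lambda>k::nat. \<integral>\<^sup>+ t. ennreal ((cmod
           (fourier_int (\<lambda>x. indicator {- real k..real k} x * g x) t - h t))\<^sup>2) \<partial>lborel)
        \<longlonglongrightarrow> 0))"

definition sobolev_norm2 :: "real \<Rightarrow> (real \<Rightarrow> complex) \<Rightarrow> ennreal" where
  "sobolev_norm2 s f = (\<integral>\<^sup>+ t. ennreal ((1 + t\<^sup>2) powr s * (cmod (fourier f t))\<^sup>2) \<partial>lborel)"

definition sobolev :: "real \<Rightarrow> (real \<Rightarrow> complex) set" where
  "sobolev s = {f \<in> L2. sobolev_norm2 s f < \<infinity>}"

definition sobolev_ball :: "real \<Rightarrow> real \<Rightarrow> (real \<Rightarrow> complex) set" where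
  "sobolev_ball p \<rho> = {f \<in> sobolev p. sobolev_norm2 p f \<le> ennreal \<rho>}"

abbreviation (input) cfun :: "(real \<Rightarrow> real) \<Rightarrow> real \<Rightarrow> complex" where
  "cfun f \<equiv> \<lambda>x. complex_of_real (f x)"

definition L2_densities :: "(real \<Rightarrow> real) set" where
  "L2_densities = {f. cfun f \<in> L2 \<and> (\<forall>x. 0 \<le> f x) \<and>
     integrable lborel f \<and> (LINT x|lborel. f x) = 1}"

definition error_densities :: "(real \<Rightarrow> real) set" where
  "error_densities = {f \<in> L2_densities. \<forall>t. (cmod (fourier (cfun f) t))\<^sup>2 > 0}"

definition supersmooth :: "real \<Rightarrow> (real \<Rightarrow> real) set" where
  "supersmooth a = {f \<in> error_densities. \<exists>d>0. \<forall>t.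
     d \<le> (1 + t\<^sup>2) powr a * inverse \<bar>ln ((cmod (fourier (cfun f) t))\<^sup>2)\<bar> \<and>
     (1 + t\<^sup>2) powr a * inverse \<bar>ln ((cmod (fourier (cfun f) t))\<^sup>2)\<bar> \<le> inverse d}"

(* Joint law of (Y_1, ..., Y_n) and (eps_1, ..., eps_m), indices shifted to start at 0.
   The convolution of the two measures is the law of Y = X + eps for independent X and eps;
   its Lebesgue density is the convolution of the densities of X and eps. *)
definition sample_law ::
    "nat \<Rightarrow> nat \<Rightarrow> (real \<Rightarrow> real) \<Rightarrow> (real \<Rightarrow> real) \<Rightarrow> ((nat \<Rightarrow> real) \<times> (nat \<Rightarrow> real)) measure" where
  "sample_law n m fX f\<epsilon> =
     (PiM {..<n} (\<lambda>_. (density lborel (\<lambda>x. ennreal (fX x)) \<star> density lborel (\<lambda>x. ennreal (f\<epsilon> x)))))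
     \<Otimes>\<^sub>M (PiM {..<m} (\<lambda>_. density lborel (\<lambda>x. ennreal (f\<epsilon> x))))"

definition sample_space :: "nat \<Rightarrow> nat \<Rightarrow> ((nat \<Rightarrow> real) \<times> (nat \<Rightarrow> real)) measure" where
  "sample_space n m = (PiM {..<n} (\<lambda>_. borel)) \<Otimes>\<^sub>M (PiM {..<m} (\<lambda>_. borel))"

(* All L2-valued estimators.  Joint measurability in the data and the argument x is no
   restriction: L2 is separable, so every Borel measurable map into L2 has such a version.
   Estimators need not be densities, nor real-valued, nor take values in H_s (their loss may
   be infinite). *)
definition estimators ::
    "nat \<Rightarrow> nat \<Rightarrow> ((nat \<Rightarrow> real) \<times> (nat \<Rightarrow> real) \<Rightarrow> real \<Rightarrow> complex) set" where
  "estimators n m = {T.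
     (\<lambda>(\<omega>, x). T \<omega> x) \<in> borel_measurable (sample_space n m \<Otimes>\<^sub>M borel) \<and>
     (\<forall>\<omega> \<in> space (sample_space n m). T \<omega> \<in> L2)}"

definition risk ::
    "real \<Rightarrow> nat \<Rightarrow> nat \<Rightarrow> ((nat \<Rightarrow> real) \<times> (nat \<Rightarrow> real) \<Rightarrow> real \<Rightarrow> complex) \<Rightarrow>
     (real \<Rightarrow> real) \<Rightarrow> (real \<Rightarrow> real) \<Rightarrow> ennreal" where
  "risk s n m T fX f\<epsilon> =
     (\<integral>\<^sup>+ \<omega>. sobolev_norm2 s (\<lambda>x. T \<omega> x - cfun fX x) \<partial>sample_law n m fX f\<epsilon>)"

end

theory Submission
  imports Defs "HOL-Real_Asymp.Real_Asymp"
begin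

text \<open>
The bound is a two-point argument: if two pairs (signal density, noise density) produce samples
that share half of their law, every estimator has, at one of the two, a risk of the order of the
squared distance of the signals.  A pair of hypotheses that the \<open>Y\<close>-sample cannot separate and one
that the noise sample cannot separate give the two summands: the supremum is at least each of the
two bounds, hence at least half of their sum.

All densities are built from Fejer kernels \<open>K\<^sub>l(x) = c (1 - cos (l x)) / (l x\<^sup>2)\<close>, whose characteristic
function is the tent \<open>max 0 (1 - \<bar>t\<bar> / l)\<close> (lemma \<open>has_bochner_integral_fejer_cos\<close>).

  \<^item> The noise is a mixture \<open>\<Sum>j. w\<^sub>j K\<^sub>j\<^sub>+\<^sub>1\<close> whose weights have the tail sums \<open>exp (- i powr (2 a))\<close>.  Its
    characteristic function at \<open>t\<close> sees only the weights beyond \<open>\<bar>t\<bar>\<close> and is therefore squeezed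
    between two exponentials of order \<open>2 a\<close>.  This gives a supersmooth density for every \<open>a > 0\<close>,
    also for \<open>a > 1\<close>, where \<open>exp (- \<bar>t\<bar> powr (2 a))\<close> itself is no characteristic function
    (\<open>fejer_mixture_supersmooth\<close>).

  \<^item> The signals are \<open>K\<^sub>l(x) (1 + h cos (k x))\<close> with a small fixed \<open>l\<close>, the frequency \<open>k = i + 1/2\<close> and
    the two amplitudes \<open>h = g\<close> and \<open>h = 2 g\<close>, where \<open>g\<close> is of order \<open>k powr (- p)\<close>.  Both lie in the
    Sobolev ball of order \<open>p\<close>, and their difference lives at the frequencies \<open>\<plusminus> k\<close>, so that its squared
    norm of order \<open>s\<close> is of order \<open>k powr (- 2 (p - s))\<close>.

  \<^item> \<open>Y\<close>-sample: the noise is the same for both signals.  The kernels \<open>K\<^sub>j\<^sub>+\<^sub>1\<close> with \<open>j < i\<close> have no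
    frequencies near \<open>k\<close>; their convolutions with the two signals have the same characteristic
    function and hence coincide.  So the two laws of \<open>Y\<close> share a component of mass
    \<open>1 - exp (- i powr (2 a))\<close>  (\<open>maximal_risk_ge_Y_sample\<close>).

  \<^item> Noise sample: all weights with index at least \<open>i\<close> are halved, and the weights of \<open>K\<^sub>1\<close> and \<open>K\<^sub>2\<close> are
    corrected so that the characteristic function of the noise does not change on \<open>[-1, 1]\<close>.  For
    \<open>\<bar>t\<bar> \<ge> i\<close> it is exactly halved.  Since the signals have frequencies only in \<open>[-l, l]\<close> and near
    \<open>\<plusminus> k\<close>, passing from \<open>g\<close> to \<open>2 g\<close> compensates this exactly: the law of \<open>Y\<close> is the same for both
    pairs, and the two noise laws share a component of mass at least \<open>1 - exp (- i powr (2 a))\<close>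
    (\<open>maximal_risk_ge_noise_sample\<close>).

If \<open>exp (- i powr (2 a)) \<le> 1 / (2 N)\<close>, then by Bernoulli's inequality the \<open>N\<close>-fold products still share
a component of mass \<open>1/2\<close>.  This holds for some \<open>i\<close> of order \<open>(ln N) powr (1 / (2 a))\<close>, which turns the
squared distance \<open>k powr (- 2 (p - s))\<close> into the rate \<open>(ln N) powr (- (p - s) / a)\<close>.

An estimator is an arbitrary square integrable function, so its transform may exist only as a limit
in the mean.  The loss is therefore bounded from below through the integral of the transform over the
band \<open>[k, k + l/2]\<close>, a linear functional that depends measurably on the data (\<open>band_fourier_diff\<close>,
\<open>band_estimator_measurable\<close>, \<open>band_fourier_le_sobolev\<close>).  Its linearity rests on the existence of
that limit, which follows from completeness and a Bessel inequality (\<open>bessel\<close>, \<open>fourier_L2_limit\<close>).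
\<close>

section \<open>The Fejer kernel and its cosine transform\<close>

text \<open>
The normalising constant of the Fejer kernel; as a number it is \<open>\<pi>\<close>.
\<close>

definition fejer_mass :: real where
  "fejer_mass = (LINT x|lborel. (1 - cos x) / x\<^sup>2)"

text \<open>
At \<open>x = 0\<close> the convention for division gives the value 0 instead of the continuous one; this changes
the kernel only on a null set.
\<close>

definition fejer :: "real \<Rightarrow> real \<Rightarrow> real" where
  "fejer l x = (1 - cos (l * x)) / (fejer_mass * l * x\<^sup>2)"

definition tent :: "real \<Rightarrow> real \<Rightarrow> real" where
  "tent l t = max 0 (1 - \<bar>t\<bar> / l)"

lemma one_minus_cos_le: "1 - cos y \<le> y\<^sup>2 / 2" for y :: real
proof -
  have "1 - cos y = 2 * (sin (y / 2))\<^sup>2"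
    using cos_double_sin[of "y/2"] by simp
  moreover have "(sin (y / 2))\<^sup>2 \<le> (y / 2)\<^sup>2"
    using abs_sin_x_le_abs_x[of "y/2"] by (simp only: abs_le_square_iff)
  ultimately show ?thesis by (simp add: power_divide)
qed

text \<open>
The integrand is at most \<open>1/2\<close> near the origin and at most \<open>2 / x\<^sup>2\<close> at infinity.
\<close>

lemma integrable_fejer_one: "integrable lborel (\<lambda>x::real. (1 - cos x) / x\<^sup>2)"
proof (rule Bochner_Integration.integrable_bound)
  show "integrable lborel (\<lambda>x::real. (5/2) * inverse (1 + x\<^sup>2))"
    using integrable_inverse_1_plus_square by (simp add: set_integrable_def)
  show "AE x::real in lborel. norm ((1 - cos x) / x\<^sup>2) \<le> norm (5/2 * inverse (1 + x\<^sup>2))"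
  proof (rule AE_I2)
    fix x :: real
    have "1 - cos x \<le> x\<^sup>2 / 2" by (rule one_minus_cos_le)
    moreover have "(1 - cos x) * x\<^sup>2 \<le> 2 * x\<^sup>2"
      by (intro mult_right_mono) (use cos_ge_minus_one[of x] in linarith, simp)
    \<comment> \<open>The constant is \<open>1/2 + 2\<close>, the sum of the bounds at the origin and at infinity.\<close>
    ultimately have "(1 - cos x) * (1 + x\<^sup>2) \<le> 5/2 * x\<^sup>2" by (simp add: algebra_simps)
    then have le: "((1 - cos x) * (1 + x\<^sup>2)) / (x\<^sup>2 * (1 + x\<^sup>2)) \<le> (5/2 * x\<^sup>2) / (x\<^sup>2 * (1 + x\<^sup>2))"
      by (rule divide_right_mono) simp
    have "1 + x\<^sup>2 \<noteq> 0" using zero_le_power2[of x] by linarith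
    with le have "(1 - cos x) / x\<^sup>2 \<le> 5/2 / (1 + x\<^sup>2)" if "x \<noteq> 0"
      using that by (simp del: times_divide_eq_left)
    then have "(1 - cos x) / x\<^sup>2 \<le> 5/2 * inverse (1 + x\<^sup>2)"
      by (cases "x = 0") (simp_all add: inverse_eq_divide)
    moreover have "0 \<le> (1 - cos x) / x\<^sup>2" by simp
    ultimately show "norm ((1 - cos x) / x\<^sup>2) \<le> norm (5/2 * inverse (1 + x\<^sup>2))"
      unfolding real_norm_def by linarith
  qed
qed simp

lemma fejer_mass_pos: "fejer_mass > 0"
proof -
  have "fejer_mass \<ge> 0" unfolding fejer_mass_def by (rule integral_nonneg_AE) simp
  moreover have "fejer_mass \<noteq> 0"
  proof
    assume "fejer_mass = 0"
    then have "AE x in lborel. (1 - cos x) / x\<^sup>2 = (0::real)"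
      unfolding fejer_mass_def
      by (subst (asm) integral_nonneg_eq_0_iff_AE) (auto intro: integrable_fejer_one)
    moreover have "1 - cos x \<noteq> 0 \<and> x\<^sup>2 \<noteq> 0" if "x \<in> {1..2}" for x :: real
      using that cos_monotone_0_pi[of 0 x] pi_ge_two by auto
    ultimately have "AE x in lborel. x \<notin> {1..2::real}"
      by (elim AE_mp) (auto intro!: AE_I2)
    then have "emeasure lborel {1..2::real} = 0"
      by (subst (asm) AE_iff_measurable[of "{1..2}"]) auto
    moreover have "emeasure lborel {1..2::real} = ennreal (2 - 1)"
      by (rule emeasure_lborel_Icc) simp
    ultimately show False by simp
  qed
  ultimately show ?thesis by simp
qed

lemma has_bochner_integral_fejer_scale:
  "has_bochner_integral lborel (\<lambda>x. (1 - cos (u * x)) / x\<^sup>2) (fejer_mass * \<bar>u\<bar>)"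
proof (cases "u = 0")
  case False
  have "has_bochner_integral lborel (\<lambda>x::real. (1 - cos x) / x\<^sup>2) fejer_mass"
    unfolding fejer_mass_def by (rule has_bochner_integral_integrable[OF integrable_fejer_one])
  then have "has_bochner_integral lborel (\<lambda>x. (1 - cos (0 + u * x)) / (0 + u * x)\<^sup>2) (fejer_mass /\<^sub>R \<bar>u\<bar>)"
    by (intro lborel_has_bochner_integral_real_affine_iff[THEN iffD1]) (use False in auto)
  then have "has_bochner_integral lborel (\<lambda>x. u\<^sup>2 * ((1 - cos (0 + u * x)) / (0 + u * x)\<^sup>2))
     (u\<^sup>2 * (fejer_mass /\<^sub>R \<bar>u\<bar>))"
    by (rule has_bochner_integral_mult_right)
  moreover have "(\<lambda>x. u\<^sup>2 * ((1 - cos (0 + u * x)) / (0 + u * x)\<^sup>2)) = (\<lambda>x. (1 - cos (u * x)) / x\<^sup>2)"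
    using False by (simp add: fun_eq_iff power_mult_distrib)
  moreover have "u\<^sup>2 * (fejer_mass /\<^sub>R \<bar>u\<bar>) = fejer_mass * \<bar>u\<bar>"
    using False by (cases "u > 0") (simp_all add: power2_eq_square field_simps)
  ultimately show ?thesis by (simp only:)
qed (simp add: has_bochner_integral_zero)

lemma fejer_nonneg: "l > 0 \<Longrightarrow> fejer l x \<ge> 0"
  unfolding fejer_def using fejer_mass_pos by (intro divide_nonneg_nonneg) auto

lemma fejer_even: "fejer l (- x) = fejer l x" by (simp add: fejer_def)

lemma fejer_measurable [measurable]: "fejer l \<in> borel_measurable borel"
  unfolding fejer_def by measurable

lemma fejer_le: "l > 0 \<Longrightarrow> fejer l x \<le> l / (2 * fejer_mass)"
proof (cases "x = 0")
  case False
  assume l: "l > 0"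
  have "fejer l x \<le> ((l * x)\<^sup>2 / 2) / (fejer_mass * l * x\<^sup>2)"
    unfolding fejer_def
  proof (rule divide_right_mono)
    show "1 - cos (l * x) \<le> (l * x)\<^sup>2 / 2" by (rule one_minus_cos_le)
    show "0 \<le> fejer_mass * l * x\<^sup>2" using l fejer_mass_pos by simp
  qed
  also have "\<dots> = l / (2 * fejer_mass)"
    using False l by (simp add: power2_eq_square)
  finally show ?thesis .
qed (use fejer_mass_pos in \<open>simp add: fejer_def\<close>)

lemma tent_eq: "l > 0 \<Longrightarrow> tent l t = (\<bar>l + t\<bar> / 2 + \<bar>l - t\<bar> / 2 - \<bar>t\<bar>) / l"
  by (auto simp: tent_def max_def field_simps abs_if)

lemma tent_eq_0: "l > 0 \<Longrightarrow> l \<le> \<bar>t\<bar> \<Longrightarrow> tent l t = 0"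
  by (simp add: tent_def max_def field_simps)

lemma tent_le_1: "l > 0 \<Longrightarrow> tent l t \<le> 1"
  by (simp add: tent_def)

lemma tent_nonneg [simp]: "0 \<le> tent l t" by (simp add: tent_def)

lemma tent_measurable [measurable]: "tent l \<in> borel_measurable borel"
  unfolding tent_def by measurable

text \<open>
By the addition theorems, \<open>cos (t x) (1 - cos (l x))\<close> is a combination of three terms
\<open>1 - cos (u x)\<close>, each of which integrates against \<open>1 / x\<^sup>2\<close> to a multiple of \<open>\<bar>u\<bar>\<close> by scaling.  The
resulting combination of absolute values is the tent.
\<close>

lemma has_bochner_integral_fejer_cos:
  assumes "l > 0"
  shows "has_bochner_integral lborel (\<lambda>x. cos (t * x) * fejer l x) (tent l t)"
proof -
  have eq: "cos (t * x) * fejer l x =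
     (1 / (fejer_mass * l)) * ((1 - cos ((l + t) * x)) / x\<^sup>2 / 2 + (1 - cos ((l - t) * x)) / x\<^sup>2 / 2
       - (1 - cos (t * x)) / x\<^sup>2)" for x
  proof -
    have "cos (t * x) * (1 - cos (l * x)) = (1 - cos ((l + t) * x)) / 2 + (1 - cos ((l - t) * x)) / 2 - (1 - cos (t * x))"
      by (simp add: distrib_right left_diff_distrib cos_add cos_diff) (simp add: field_simps)
    then have "cos (t * x) * fejer l x = (1 / (fejer_mass * l)) *
       (((1 - cos ((l + t) * x)) / 2 + (1 - cos ((l - t) * x)) / 2 - (1 - cos (t * x))) / x\<^sup>2)"
      by (simp add: fejer_def mult_ac)
    then show ?thesis by (simp add: add_divide_distrib diff_divide_distrib divide_divide_eq_left' mult.commute)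
  qed
  have "has_bochner_integral lborel (\<lambda>x. cos (t * x) * fejer l x)
     ((1 / (fejer_mass * l)) * (fejer_mass * \<bar>l + t\<bar> / 2 + fejer_mass * \<bar>l - t\<bar> / 2 - fejer_mass * \<bar>t\<bar>))"
    unfolding eq
    by (intro has_bochner_integral_mult_right has_bochner_integral_diff has_bochner_integral_add
        has_bochner_integral_divide has_bochner_integral_fejer_scale)
  also have "(1 / (fejer_mass * l)) * (fejer_mass * \<bar>l + t\<bar> / 2 + fejer_mass * \<bar>l - t\<bar> / 2 - fejer_mass * \<bar>t\<bar>) = tent l t"
    using fejer_mass_pos assms by (simp add: tent_eq field_simps)
  finally show ?thesis .
qed

lemma has_bochner_integral_fejer:
  "l > 0 \<Longrightarrow> has_bochner_integral lborel (fejer l) 1"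
  using has_bochner_integral_fejer_cos[of l 0] by (simp add: tent_def)

lemma integrable_fejer: "l > 0 \<Longrightarrow> integrable lborel (fejer l)"
  using has_bochner_integral_fejer by (auto simp: has_bochner_integral_iff)

section \<open>Even densities, their characteristic functions and convolutions\<close>

text \<open>
For an even density this is the characteristic function.
\<close>

definition cos_transform :: "(real \<Rightarrow> real) \<Rightarrow> real \<Rightarrow> real" where
  "cos_transform f t = (LINT x|lborel. cos (t * x) * f x)"

lemma integrable_bounded_times:
  fixes f h :: "real \<Rightarrow> real"
  assumes "integrable lborel f" "h \<in> borel_measurable borel" "\<And>x. \<bar>h x\<bar> \<le> 1"
  shows "integrable lborel (\<lambda>x. h x * f x)"
proof (rule Bochner_Integration.integrable_bound[OF assms(1)])
  show "(\<lambda>x. h x * f x) \<in> borel_measurable lborel" using assms(1,2) by auto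
  show "AE x in lborel. norm (h x * f x) \<le> norm (f x)"
    using assms(3) by (intro AE_I2) (simp add: abs_mult mult_left_le_one_le)
qed

lemma lborel_integral_odd:
  fixes g :: "real \<Rightarrow> real"
  assumes "\<And>x. g (- x) = - g x"
  shows "(LINT x|lborel. g x) = 0"
  using lborel_integral_real_affine[of "-1" g 0] assms by simp

text \<open>
The sine part has an odd integrand.
\<close>

lemma integral_iexp_even:
  fixes f :: "real \<Rightarrow> real"
  assumes f: "integrable lborel f" and even: "\<And>x. f (- x) = f x"
  shows "(CLINT x|lborel. iexp (t * x) * complex_of_real (f x)) = complex_of_real (cos_transform f t)"
proof -
  have i: "integrable lborel (\<lambda>x. cos (t * x) * f x)" "integrable lborel (\<lambda>x. sin (t * x) * f x)"
    by (auto intro!: integrable_bounded_times[OF f])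
  have "(CLINT x|lborel. iexp (t * x) * complex_of_real (f x)) =
     (CLINT x|lborel. complex_of_real (cos (t * x) * f x) + \<i> * complex_of_real (sin (t * x) * f x))"
    by (intro Bochner_Integration.integral_cong)
       (simp_all add: complex_eq_iff Re_exp Im_exp)
  also have "\<dots> = complex_of_real (LINT x|lborel. cos (t * x) * f x) + \<i> * complex_of_real (LINT x|lborel. sin (t * x) * f x)"
    using i by (subst Bochner_Integration.integral_add) (auto simp del: of_real_mult)
  also have "(LINT x|lborel. sin (t * x) * f x) = 0"
    by (rule lborel_integral_odd) (simp add: even)
  finally show ?thesis by (simp add: cos_transform_def)
qed

lemma cos_transform_uminus: "cos_transform f (- t) = cos_transform f t"
  by (simp add: cos_transform_def)

lemma fourier_int_even:
  assumes f: "integrable lborel f" and even: "\<And>x. f (- x) = f x"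
  shows "fourier_int (cfun f) t = complex_of_real (cos_transform f t / sqrt (2 * pi))"
  using integral_iexp_even[OF assms, of "- t"]
  by (simp add: fourier_int_def cos_transform_uminus)

definition even_densities :: "(real \<Rightarrow> real) set" where
  "even_densities = {f \<in> L2_densities. \<forall>x. f (- x) = f x}"

lemma even_densitiesD:
  assumes "f \<in> even_densities"
  shows "f \<in> borel_measurable borel" "\<And>x. f x \<ge> 0" "\<And>x. f (- x) = f x" "integrable lborel f"
    "(LINT x|lborel. f x) = 1" "cfun f \<in> L2"
  using assms unfolding even_densities_def L2_densities_def by auto

text \<open>
A bounded density \<open>f \<le> B\<close> is square integrable because \<open>f\<^sup>2 \<le> B f\<close>.
\<close>

lemma even_densitiesI:
  assumes [measurable]: "f \<in> borel_measurable borel"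
    and "\<And>x. f x \<ge> 0" "\<And>x. f x \<le> B" "\<And>x. f (- x) = f x" "has_bochner_integral lborel f 1"
  shows "f \<in> even_densities"
proof -
  have f: "integrable lborel f" using assms by (auto simp: has_bochner_integral_iff)
  have "integrable lborel (\<lambda>x. (f x)\<^sup>2)"
  proof (rule Bochner_Integration.integrable_bound[of _ "\<lambda>x. B * f x"])
    show "AE x in lborel. norm ((f x)\<^sup>2) \<le> norm (B * f x)"
    proof (rule AE_I2)
      fix x
      have "(f x)\<^sup>2 \<le> B * f x" using assms(2,3)[of x] by (simp add: power2_eq_square mult_right_mono)
      then show "norm ((f x)\<^sup>2) \<le> norm (B * f x)" by simp
    qed
  qed (use f in auto)
  then show ?thesis
    using assms f by (auto simp: even_densities_def L2_densities_def L2_def has_bochner_integral_iff)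
qed

lemma fourier_even_density:
  assumes "f \<in> even_densities"
  shows "fourier (cfun f) t = complex_of_real (cos_transform f t / sqrt (2 * pi))"
  using even_densitiesD[OF assms] by (simp add: fourier_def fourier_int_even)

abbreviation law :: "(real \<Rightarrow> real) \<Rightarrow> real measure" where
  "law f \<equiv> density lborel (\<lambda>x. ennreal (f x))"

lemma real_distribution_law:
  assumes "f \<in> even_densities"
  shows "real_distribution (law f)"
proof -
  note f = even_densitiesD[OF assms]
  have "emeasure (law f) UNIV = 1"
    using f by (simp add: emeasure_density nn_integral_eq_integral)
  then interpret prob_space "law f" by (intro prob_spaceI) simp
  show ?thesis by unfold_locales auto
qed

lemma char_law:
  assumes "f \<in> even_densities"
  shows "char (law f) t = complex_of_real (cos_transform f t)"
proof -
  note f = even_densitiesD[OF assms]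
  have "char (law f) t = (CLINT x|lborel. f x *\<^sub>R iexp (t * x))"
    unfolding char_def using f by (subst integral_density) auto
  also have "\<dots> = (CLINT x|lborel. iexp (t * x) * complex_of_real (f x))"
    by (simp add: scaleR_conv_of_real mult.commute)
  finally show ?thesis using integral_iexp_even[OF f(4,3)] by simp
qed

lemma real_distribution_convolution:
  assumes "real_distribution M" "real_distribution N"
  shows "real_distribution (M \<star> N)"
proof -
  interpret M: real_distribution M by fact
  interpret N: real_distribution N by fact
  interpret P: pair_prob_space M N ..
  interpret C: prob_space "M \<star> N"
    unfolding convolution_def by (rule P.prob_space_distr) measurable
  show ?thesis by unfold_locales auto
qed

lemma char_convolution:
  assumes "real_distribution M" "real_distribution N"
  shows "char (M \<star> N) t = char M t * char N t"
proof -
  interpret M: real_distribution M by fact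
  interpret N: real_distribution N by fact
  interpret P: pair_prob_space M N ..
  have int: "integrable (M \<Otimes>\<^sub>M N) (\<lambda>(x, y). iexp (t * x) * iexp (t * y))"
    by (rule P.integrable_const_bound[where B = 1]) (auto simp: norm_mult)
  have "char (M \<star> N) t = (CLINT z|M \<Otimes>\<^sub>M N. case z of (x, y) \<Rightarrow> iexp (t * x) * iexp (t * y))"
    unfolding char_def convolution_def
    by (subst integral_distr)
       (auto simp: distrib_left exp_add[symmetric] intro!: Bochner_Integration.integral_cong)
  also have "\<dots> = (CLINT x|M. CLINT y|N. iexp (t * x) * iexp (t * y))"
    using P.integral_fst'[OF int] by simp
  also have "\<dots> = char M t * char N t"
    by (simp add: char_def)
  finally show ?thesis .
qed

text \<open>
This is how two different pairs of signal and noise produce the same observations: by Levy's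
uniqueness theorem only the product of the characteristic functions matters.
\<close>

lemma convolution_law_eqI:
  assumes "f \<in> even_densities" "g \<in> even_densities" "f' \<in> even_densities" "g' \<in> even_densities"
    and "\<And>t. cos_transform f t * cos_transform g t = cos_transform f' t * cos_transform g' t"
  shows "(law f \<star> law g) = (law f' \<star> law g')"
proof (rule Levy_uniqueness)
  show "char (law f \<star> law g) = char (law f' \<star> law g')"
    using assms by (auto simp: fun_eq_iff char_convolution real_distribution_law char_law simp flip: of_real_mult)
qed (auto intro!: real_distribution_convolution real_distribution_law assms)

section \<open>Mixtures and modulations of Fejer kernels\<close>

definition fejer_mixture :: "(nat \<Rightarrow> real) \<Rightarrow> real \<Rightarrow> real" where
  "fejer_mixture w x = (\<Sum>j. w j * fejer (real j + 1) x)"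

text \<open>
The finite first moment makes the mixture bounded, because \<open>K\<^sub>l\<close> is bounded by a multiple of \<open>l\<close>.
\<close>

definition weights :: "(nat \<Rightarrow> real) set" where
  "weights = {w. (\<forall>j. 0 \<le> w j) \<and> w sums 1 \<and> summable (\<lambda>j. w j * (real j + 1))}"

context
  fixes w :: "nat \<Rightarrow> real"
  assumes w: "w \<in> weights"
begin

lemma weights_nonneg: "0 \<le> w j" and weights_sums: "w sums 1" and weights_moment: "summable (\<lambda>j. w j * (real j + 1))"
  using w by (auto simp: weights_def)

lemma summable_fejer_mixture: "summable (\<lambda>j. w j * fejer (real j + 1) x)"
proof (rule summable_comparison_test')
  show "summable (\<lambda>j. w j * (real j + 1) * (1 / (2 * fejer_mass)))"
    by (rule summable_mult2[OF weights_moment])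
  show "norm (w j * fejer (real j + 1) x) \<le> w j * (real j + 1) * (1 / (2 * fejer_mass))" for j
    using mult_left_mono[OF fejer_le[of "real j + 1" x] weights_nonneg[of j]] weights_nonneg[of j] fejer_nonneg[of "real j + 1" x]
    by (simp add: abs_mult)
qed

lemma integral_times_fejer_mixture_sums:
  assumes h[measurable]: "h \<in> borel_measurable borel" and h1: "\<And>x. \<bar>h x\<bar> \<le> 1"
  shows "integrable lborel (\<lambda>x. h x * fejer_mixture w x)"
    and "(\<lambda>j. w j * (LINT x|lborel. h x * fejer (real j + 1) x)) sums (LINT x|lborel. h x * fejer_mixture w x)"
proof -
  let ?f = "\<lambda>j x. h x * (w j * fejer (real j + 1) x)"
  have n: "norm (?f j x) = \<bar>h x\<bar> * (w j * fejer (real j + 1) x)" for j x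
    using weights_nonneg[of j] fejer_nonneg[of "real j + 1" x] by (simp add: abs_mult)
  have i: "integrable lborel (?f j)" for j
    by (rule integrable_bounded_times[OF integrable_mult_right h h1]) (simp add: integrable_fejer)
  have s: "AE x in lborel. summable (\<lambda>j. norm (?f j x))"
    unfolding n by (intro AE_I2 summable_mult summable_fejer_mixture)
  have m: "summable (\<lambda>j. LINT x|lborel. norm (?f j x))"
  proof (rule summable_comparison_test')
    show "summable w" using weights_sums by (simp add: sums_iff)
    fix j
    have "(LINT x|lborel. norm (?f j x)) \<le> (LINT x|lborel. w j * fejer (real j + 1) x)"
      using h1 weights_nonneg[of j] fejer_nonneg[of "real j + 1"]
      by (intro integral_mono_AE integrable_norm i integrable_mult_right integrable_fejer AE_I2)
         (auto simp: abs_mult intro!: mult_left_le_one_le)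
    also have "\<dots> = w j"
      using has_bochner_integral_fejer[of "real j + 1"] by (simp add: has_bochner_integral_iff)
    finally show "norm (LINT x|lborel. norm (?f j x)) \<le> w j" by simp
  qed
  have e: "h x * fejer_mixture w x = (\<Sum>j. ?f j x)" for x
    unfolding fejer_mixture_def by (rule suminf_mult[symmetric]) (rule summable_fejer_mixture)
  show "integrable lborel (\<lambda>x. h x * fejer_mixture w x)"
    unfolding e by (rule integrable_suminf[OF i s m])
  have "(\<lambda>j. LINT x|lborel. ?f j x) sums (LINT x|lborel. h x * fejer_mixture w x)"
    unfolding e by (rule sums_integral[OF i s m])
  moreover have "(LINT x|lborel. ?f j x) = w j * (LINT x|lborel. h x * fejer (real j + 1) x)" for j
    by (subst integral_mult_right_zero[symmetric]) (simp add: mult_ac)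
  ultimately show "(\<lambda>j. w j * (LINT x|lborel. h x * fejer (real j + 1) x)) sums (LINT x|lborel. h x * fejer_mixture w x)"
    by simp
qed

lemma cos_transform_fejer_mixture_sums: "(\<lambda>j. w j * tent (real j + 1) t) sums cos_transform (fejer_mixture w) t"
proof -
  have "(LINT x|lborel. cos (t * x) * fejer (real j + 1) x) = tent (real j + 1) t" for j
    using has_bochner_integral_fejer_cos[of "real j + 1" t] by (simp add: has_bochner_integral_iff)
  then show ?thesis
    using integral_times_fejer_mixture_sums(2)[of "\<lambda>x. cos (t * x)"] by (simp add: cos_transform_def)
qed

lemma fejer_mixture_even_density: "fejer_mixture w \<in> even_densities"
proof (rule even_densitiesI)
  show "fejer_mixture w \<in> borel_measurable borel" unfolding fejer_mixture_def by measurable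
  show "fejer_mixture w x \<ge> 0" for x
    unfolding fejer_mixture_def using weights_nonneg fejer_nonneg by (intro suminf_nonneg summable_fejer_mixture) simp
  show "fejer_mixture w x \<le> (\<Sum>j. w j * (real j + 1) * (1 / (2 * fejer_mass)))" for x
    unfolding fejer_mixture_def
    using mult_left_mono[OF fejer_le weights_nonneg]
    by (intro suminf_le summable_fejer_mixture summable_mult2 weights_moment) simp
  show "fejer_mixture w (- x) = fejer_mixture w x" for x
    unfolding fejer_mixture_def by (simp add: fejer_even)
  have "w sums (LINT x|lborel. fejer_mixture w x)"
    using integral_times_fejer_mixture_sums(2)[of "\<lambda>_. 1"] has_bochner_integral_fejer by (simp add: has_bochner_integral_iff)
  then have "(LINT x|lborel. fejer_mixture w x) = 1" using weights_sums by (rule sums_unique2)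
  then show "has_bochner_integral lborel (fejer_mixture w) 1"
    using integral_times_fejer_mixture_sums(1)[of "\<lambda>_. 1"] by (simp add: has_bochner_integral_iff)
qed

end

definition modulated_fejer :: "real \<Rightarrow> real \<Rightarrow> real \<Rightarrow> real \<Rightarrow> real" where
  "modulated_fejer l k g x = fejer l x * (1 + g * cos (k * x))"

text \<open>
Modulation by \<open>cos (k x)\<close> moves copies of the tent to the frequencies \<open>\<plusminus> k\<close>.
\<close>

lemma has_bochner_integral_modulated_fejer_cos:
  assumes "l > 0"
  shows "has_bochner_integral lborel (\<lambda>x. cos (t * x) * modulated_fejer l k g x)
     (tent l t + g / 2 * (tent l (t - k) + tent l (t + k)))"
proof -
  have eq: "cos (t * x) * modulated_fejer l k g x =
    cos (t * x) * fejer l x + g / 2 * (cos ((t - k) * x) * fejer l x + cos ((t + k) * x) * fejer l x)" for x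
  proof -
    have "cos (t * x) * cos (k * x) = (cos ((t - k) * x) + cos ((t + k) * x)) / 2"
      by (simp add: left_diff_distrib distrib_right cos_add cos_diff)
    then have "cos (t * x) * cos (k * x) * (g * fejer l x) =
       (cos ((t - k) * x) + cos ((t + k) * x)) / 2 * (g * fejer l x)" by (rule arg_cong)
    then show ?thesis by (simp add: modulated_fejer_def algebra_simps)
  qed
  show ?thesis unfolding eq
    by (intro has_bochner_integral_add has_bochner_integral_mult_right has_bochner_integral_fejer_cos assms)
qed

lemma cos_transform_modulated_fejer:
  "l > 0 \<Longrightarrow> cos_transform (modulated_fejer l k g) t = tent l t + g / 2 * (tent l (t - k) + tent l (t + k))"
  using has_bochner_integral_modulated_fejer_cos by (auto simp: cos_transform_def has_bochner_integral_iff)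

lemma modulated_fejer_even_density:
  assumes "l > 0" "l \<le> \<bar>k\<bar>" "0 \<le> g" "g \<le> 1"
  shows "modulated_fejer l k g \<in> even_densities"
proof (rule even_densitiesI)
  have c: "0 \<le> 1 + g * cos y \<and> 1 + g * cos y \<le> 2" for y
  proof -
    have "\<bar>g * cos y\<bar> \<le> 1 * 1" unfolding abs_mult using assms by (intro mult_mono) auto
    then show ?thesis by linarith
  qed
  show "modulated_fejer l k g \<in> borel_measurable borel" unfolding modulated_fejer_def by measurable
  show "modulated_fejer l k g x \<ge> 0" for x
    unfolding modulated_fejer_def using c fejer_nonneg assms by simp
  show "modulated_fejer l k g x \<le> l / (2 * fejer_mass) * 2" for x
    unfolding modulated_fejer_def using c fejer_le[OF assms(1)] fejer_nonneg[OF assms(1)] fejer_mass_pos assms(1)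
    by (intro mult_mono) auto
  show "modulated_fejer l k g (- x) = modulated_fejer l k g x" for x
    by (simp add: modulated_fejer_def fejer_even)
  have "tent l 0 + g / 2 * (tent l (0 - k) + tent l (0 + k)) = 1"
    using assms by (simp add: tent_def max_def)
  then show "has_bochner_integral lborel (modulated_fejer l k g) 1"
    using has_bochner_integral_modulated_fejer_cos[OF assms(1), of 0 k g] by simp
qed

section \<open>Laws with a common component\<close>

text \<open>
For probability measures: \<open>M\<close> is a component of \<open>N\<close> with weight \<open>c\<close>.  Stating this through
nonnegative integrals makes the passage to product measures an iteration of integrals.
\<close>

definition dominates :: "real \<Rightarrow> 'a measure \<Rightarrow> 'a measure \<Rightarrow> bool" where
  "dominates c N M \<longleftrightarrow> sets N = sets M \<and>
     (\<forall>f \<in> borel_measurable M. ennreal c * (\<integral>\<^sup>+x. f x \<partial>M) \<le> (\<integral>\<^sup>+x. f x \<partial>N))"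

lemma dominates_refl: "dominates 1 M M"
  by (simp add: dominates_def)

lemma dominates_PiM:
  fixes M N :: "real measure"
  assumes d: "dominates c N M" and c: "c \<ge> 0" and M: "prob_space M" and N: "prob_space N"
  shows "dominates (c ^ n) (PiM {..<n} (\<lambda>_. N)) (PiM {..<n} (\<lambda>_. M))"
proof -
  interpret M: prob_space M by fact
  interpret N: prob_space N by fact
  interpret PM: product_sigma_finite "\<lambda>_::nat. M" ..
  interpret PN: product_sigma_finite "\<lambda>_::nat. N" ..
  have sets[measurable_cong]: "sets N = sets M" using d by (simp add: dominates_def)
  have "ennreal (c ^ n) * (\<integral>\<^sup>+x. f x \<partial>PiM {..<n} (\<lambda>_. M)) \<le> (\<integral>\<^sup>+x. f x \<partial>PiM {..<n} (\<lambda>_. N))"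
    if "f \<in> borel_measurable (PiM {..<n} (\<lambda>_. M))" for f
    using that
  proof (induction n arbitrary: f)
    case 0
    have [simp]: "PiM {} (\<lambda>_::nat. N) = PiM {} (\<lambda>_::nat. M)"
      by (intro measure_eqI) (auto simp: PiM_empty)
    show ?case by simp
  next
    case (Suc n)
    have ins: "{..<Suc n} = insert n {..<n}" by auto
    note [measurable] = Suc.prems[unfolded ins]
    have fN: "f \<in> borel_measurable (PiM (insert n {..<n}) (\<lambda>_. N))"
      by measurable
    have "ennreal (c ^ Suc n) * (\<integral>\<^sup>+x. f x \<partial>PiM {..<Suc n} (\<lambda>_. M)) =
        ennreal (c ^ n) * (ennreal c * (\<integral>\<^sup>+x. \<integral>\<^sup>+y. f (x(n := y)) \<partial>M \<partial>PiM {..<n} (\<lambda>_. M)))"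
      using c unfolding ins
      by (subst PM.product_nn_integral_insert) (simp_all add: ennreal_mult mult_ac Suc.prems[unfolded ins])
    also have "\<dots> = ennreal (c ^ n) * (\<integral>\<^sup>+x. ennreal c * (\<integral>\<^sup>+y. f (x(n := y)) \<partial>M) \<partial>PiM {..<n} (\<lambda>_. M))"
      by (subst nn_integral_cmult) simp_all
    also have "\<dots> \<le> ennreal (c ^ n) * (\<integral>\<^sup>+x. \<integral>\<^sup>+y. f (x(n := y)) \<partial>N \<partial>PiM {..<n} (\<lambda>_. M))"
      using d by (intro mult_left_mono nn_integral_mono) (auto simp: dominates_def)
    also have "\<dots> \<le> (\<integral>\<^sup>+x. \<integral>\<^sup>+y. f (x(n := y)) \<partial>N \<partial>PiM {..<n} (\<lambda>_. N))"
      by (rule Suc.IH) measurable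
    also have "\<dots> = (\<integral>\<^sup>+x. f x \<partial>PiM {..<Suc n} (\<lambda>_. N))"
      unfolding ins by (subst PN.product_nn_integral_insert) (simp_all add: fN)
    finally show ?case .
  qed
  moreover have "sets (PiM {..<n} (\<lambda>_. N)) = sets (PiM {..<n} (\<lambda>_. M))"
    by (intro sets_PiM_cong) (auto simp: sets)
  ultimately show ?thesis by (simp add: dominates_def)
qed

lemma dominates_pair:
  assumes d1: "dominates c N M" and d2: "dominates c' N' M'" and "c \<ge> 0" "c' \<ge> 0"
    and "prob_space M'" "prob_space N'"
  shows "dominates (c * c') (N \<Otimes>\<^sub>M N') (M \<Otimes>\<^sub>M M')"
proof -
  interpret M': prob_space M' by fact
  interpret N': prob_space N' by fact
  have sets[measurable_cong]: "sets N = sets M" "sets N' = sets M'" using d1 d2 by (auto simp: dominates_def)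
  have "ennreal (c * c') * (\<integral>\<^sup>+x. f x \<partial>(M \<Otimes>\<^sub>M M')) \<le> (\<integral>\<^sup>+x. f x \<partial>(N \<Otimes>\<^sub>M N'))"
    if [measurable]: "f \<in> borel_measurable (M \<Otimes>\<^sub>M M')" for f
  proof -
    have fN: "f \<in> borel_measurable (N \<Otimes>\<^sub>M N')" by measurable
    have "ennreal (c * c') * (\<integral>\<^sup>+x. f x \<partial>(M \<Otimes>\<^sub>M M')) = ennreal c * (ennreal c' * (\<integral>\<^sup>+x. \<integral>\<^sup>+y. f (x, y) \<partial>M' \<partial>M))"
      using assms by (subst M'.nn_integral_fst[symmetric]) (simp_all add: ennreal_mult mult_ac)
    also have "\<dots> = ennreal c * (\<integral>\<^sup>+x. ennreal c' * (\<integral>\<^sup>+y. f (x, y) \<partial>M') \<partial>M)"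
      by (subst nn_integral_cmult) simp_all
    also have "\<dots> \<le> ennreal c * (\<integral>\<^sup>+x. \<integral>\<^sup>+y. f (x, y) \<partial>N' \<partial>M)"
      using d2 by (intro mult_left_mono nn_integral_mono) (auto simp: dominates_def)
    also have "\<dots> \<le> (\<integral>\<^sup>+x. \<integral>\<^sup>+y. f (x, y) \<partial>N' \<partial>N)"
    proof -
      have "(\<lambda>x. \<integral>\<^sup>+y. f (x, y) \<partial>N') \<in> borel_measurable M" by measurable
      then show ?thesis using d1 by (auto simp: dominates_def)
    qed
    also have "\<dots> = (\<integral>\<^sup>+x. f x \<partial>(N \<Otimes>\<^sub>M N'))"
      using fN by (subst N'.nn_integral_fst[symmetric]) simp_all
    finally show ?thesis .
  qed
  moreover have "sets (N \<Otimes>\<^sub>M N') = sets (M \<Otimes>\<^sub>M M')"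
    by (intro sets_pair_measure_cong sets)
  ultimately show ?thesis by (simp add: dominates_def)
qed

lemma dominates_law:
  assumes [measurable]: "f \<in> borel_measurable borel" "g \<in> borel_measurable borel"
    and "c \<ge> 0" and le: "\<And>x. c * f x \<le> g x"
  shows "dominates c (law g) (law f)"
  unfolding dominates_def
proof safe
  fix h :: "real \<Rightarrow> ennreal" assume "h \<in> borel_measurable (law f)"
  then have [measurable]: "h \<in> borel_measurable borel" by simp
  have "ennreal c * (\<integral>\<^sup>+x. h x \<partial>law f) = (\<integral>\<^sup>+x. ennreal c * (ennreal (f x) * h x) \<partial>lborel)"
    by (subst nn_integral_density) (simp_all add: nn_integral_cmult)
  also have "\<dots> \<le> (\<integral>\<^sup>+x. ennreal (g x) * h x \<partial>lborel)"
    using le \<open>c \<ge> 0\<close> by (intro nn_integral_mono) (auto simp flip: mult.assoc simp: ennreal_mult'[symmetric] intro!: mult_right_mono ennreal_leI)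
  also have "\<dots> = (\<integral>\<^sup>+x. h x \<partial>law g)" by (subst nn_integral_density) simp_all
  finally show "ennreal c * (\<integral>\<^sup>+x. h x \<partial>law f) \<le> (\<integral>\<^sup>+x. h x \<partial>law g)" .
qed simp_all

text \<open>
Convolution with a fixed law keeps a common component, so a component shared by two noise laws yields
one of the laws of \<open>Y\<close>.
\<close>

lemma dominates_convolution:
  assumes "real_distribution L" "real_distribution M" "real_distribution N"
    and d: "dominates c N M" and c: "c \<ge> 0"
  shows "dominates c (L \<star> N) (L \<star> M)"
  unfolding dominates_def
proof safe
  interpret L: real_distribution L by fact
  interpret M: real_distribution M by fact
  interpret N: real_distribution N by fact
  fix h :: "real \<Rightarrow> ennreal" assume "h \<in> borel_measurable (L \<star> M)"
  then have [measurable]: "h \<in> borel_measurable borel" by simp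
  have "ennreal c * (\<integral>\<^sup>+x. h x \<partial>(L \<star> M)) = ennreal c * (\<integral>\<^sup>+x. \<integral>\<^sup>+y. h (x + y) \<partial>M \<partial>L)"
    by (subst nn_integral_convolution) (auto simp: L.finite_measure_axioms M.finite_measure_axioms)
  also have "\<dots> = (\<integral>\<^sup>+x. ennreal c * (\<integral>\<^sup>+y. h (x + y) \<partial>M) \<partial>L)"
    by (subst nn_integral_cmult) auto
  also have "\<dots> \<le> (\<integral>\<^sup>+x. \<integral>\<^sup>+y. h (x + y) \<partial>N \<partial>L)"
    using d by (intro nn_integral_mono) (auto simp: dominates_def)
  also have "\<dots> = (\<integral>\<^sup>+x. h x \<partial>(L \<star> N))"
    by (subst nn_integral_convolution) (auto simp: L.finite_measure_axioms N.finite_measure_axioms)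
  finally show "ennreal c * (\<integral>\<^sup>+x. h x \<partial>(L \<star> M)) \<le> (\<integral>\<^sup>+x. h x \<partial>(L \<star> N))" .
qed simp_all

section \<open>A Bessel inequality\<close>

abbreviation sq_norm :: "(real \<Rightarrow> complex) \<Rightarrow> ennreal" where
  "sq_norm u \<equiv> \<integral>\<^sup>+x. ennreal ((cmod (u x))\<^sup>2) \<partial>lborel"

lemma L2_iff: "u \<in> L2 \<longleftrightarrow> u \<in> borel_measurable borel \<and> sq_norm u < \<infinity>"
  by (auto simp: L2_def integrable_iff_bounded)

lemma cmod_diff_sq_le: "(cmod (x - y))\<^sup>2 \<le> 2 * (cmod x)\<^sup>2 + 2 * (cmod y)\<^sup>2"
proof -
  have "(cmod (x - y))\<^sup>2 \<le> (cmod x + cmod y)\<^sup>2"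
    by (intro power_mono norm_triangle_ineq4) simp
  also have "\<dots> \<le> 2 * (cmod x)\<^sup>2 + 2 * (cmod y)\<^sup>2"
    using zero_le_power2[of "cmod x - cmod y"] by (simp add: power2_eq_square algebra_simps)
  finally show ?thesis .
qed

lemma L2_diff:
  assumes "u \<in> L2" "v \<in> L2"
  shows "(\<lambda>x. u x - v x) \<in> L2"
proof -
  have [measurable]: "u \<in> borel_measurable borel" "v \<in> borel_measurable borel"
    and i: "integrable lborel (\<lambda>x. (cmod (u x))\<^sup>2)" "integrable lborel (\<lambda>x. (cmod (v x))\<^sup>2)"
    using assms by (auto simp: L2_def)
  have "integrable lborel (\<lambda>x. (cmod (u x - v x))\<^sup>2)"
    by (rule Bochner_Integration.integrable_bound[of _ "\<lambda>x. 2 * (cmod (u x))\<^sup>2 + 2 * (cmod (v x))\<^sup>2"])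
       (auto simp: i cmod_diff_sq_le)
  then show ?thesis by (simp add: L2_def)
qed

lemma integrable_unimodular_times:
  fixes g e :: "real \<Rightarrow> complex"
  assumes "integrable lborel g" "e \<in> borel_measurable borel" "\<And>x. cmod (e x) \<le> 1"
  shows "integrable lborel (\<lambda>x. e x * g x)"
proof (rule Bochner_Integration.integrable_bound[OF assms(1)])
  show "(\<lambda>x. e x * g x) \<in> borel_measurable lborel" using assms(1,2) by auto
  show "AE x in lborel. norm (e x * g x) \<le> norm (g x)"
    using assms(3) by (intro AE_I2) (simp add: norm_mult mult_left_le_one_le)
qed

definition osc :: "real \<Rightarrow> real \<Rightarrow> complex" where
  "osc t x = exp (- \<i> * of_real (t * x))"

lemma osc_measurable [measurable]: "(\<lambda>(t, x). osc t x) \<in> borel_measurable (borel \<Otimes>\<^sub>M borel)"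
  unfolding osc_def by measurable

lemma cmod_osc [simp]: "cmod (osc t x) = 1"
  by (simp add: osc_def)

lemma osc_commute: "osc t x = osc x t"
  by (simp add: osc_def mult.commute)

lemma osc_mult_add: "osc x t * osc y t = osc (x + y) t"
  by (simp add: osc_def exp_add[symmetric] algebra_simps)

lemma cnj_osc: "cnj (osc t x) = osc t (- x)"
  by (simp add: osc_def exp_cnj)

lemma fourier_int_osc: "fourier_int g t = complex_of_real (1 / sqrt (2 * pi)) * (LINT x|lborel. osc t x * g x)"
  by (simp add: fourier_int_def osc_def)

lemma integrable_osc_times:
  fixes g :: "real \<Rightarrow> complex"
  assumes "integrable lborel g"
  shows "integrable lborel (\<lambda>x. osc t x * g x)"
  by (rule integrable_unimodular_times[OF assms]) auto

lemma fourier_int_diff: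
  assumes "integrable lborel u" "integrable lborel v"
  shows "fourier_int (\<lambda>x. u x - v x) t = fourier_int u t - fourier_int v t"
  unfolding fourier_int_osc
  by (simp add: right_diff_distrib Bochner_Integration.integral_diff integrable_osc_times assms)

lemma fourier_int_measurable [measurable]:
  assumes [measurable]: "u \<in> borel_measurable borel"
  shows "fourier_int u \<in> borel_measurable borel"
  unfolding fourier_int_osc by measurable

lemma cmod_fourier_int_le:
  "cmod (LINT x|lborel. osc t x * u x) \<le> (LINT x|lborel. cmod (u x))"
proof -
  have "cmod (LINT x|lborel. osc t x * u x) \<le> (LINT x|lborel. cmod (osc t x * u x))"
    by (rule integral_norm_bound)
  then show ?thesis by (simp add: norm_mult)
qed

text \<open>
The multiplication formula: Fubini's theorem moves the transform from one factor to the other.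
\<close>

lemma fourier_multiplication:
  fixes f g :: "real \<Rightarrow> complex"
  assumes f: "integrable lborel f" and g: "integrable lborel g"
  shows "(LINT t|lborel. f t * (LINT x|lborel. osc t x * g x)) =
         (LINT x|lborel. g x * (LINT t|lborel. osc x t * f t))"
proof -
  have [measurable]: "f \<in> borel_measurable borel" "g \<in> borel_measurable borel" using f g by auto
  let ?h = "\<lambda>(t, x). f t * (osc t x * g x)"
  have int: "integrable (lborel \<Otimes>\<^sub>M lborel) ?h"
  proof (rule lborel_pair.Fubini_integrable)
    show "?h \<in> borel_measurable (lborel \<Otimes>\<^sub>M lborel)" by measurable
    show "integrable lborel (\<lambda>t. LINT x|lborel. norm (?h (t, x)))"
      using f g by (simp add: norm_mult)
    show "AE t in lborel. integrable lborel (\<lambda>x. ?h (t, x))"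
      by (auto intro!: integrable_mult_right integrable_osc_times[OF g])
  qed
  have "(LINT t|lborel. LINT x|lborel. f t * (osc t x * g x)) =
      (LINT x|lborel. LINT t|lborel. f t * (osc t x * g x))"
    using lborel_pair.Fubini_integral[of "\<lambda>t x. f t * (osc t x * g x)"] int by simp
  moreover have "(LINT x|lborel. f t * (osc t x * g x)) = f t * (LINT x|lborel. osc t x * g x)" for t
    by simp
  moreover have "(LINT t|lborel. f t * (osc t x * g x)) = g x * (LINT t|lborel. osc x t * f t)" for x
    by (subst integral_mult_right_zero[symmetric]) (simp add: mult_ac osc_commute)
  ultimately show ?thesis by simp
qed

lemma nn_integral_tent_le:
  assumes "l > 0"
  shows "(\<integral>\<^sup>+t. ennreal (tent l (x + t)) \<partial>lborel) \<le> ennreal (2 * l)"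
proof -
  have "(\<integral>\<^sup>+t. ennreal (tent l (x + t)) \<partial>lborel) \<le> (\<integral>\<^sup>+t. indicator {- l - x..l - x} t \<partial>lborel)"
    using assms by (intro nn_integral_mono) (auto simp: tent_def indicator_def max_def field_simps abs_if split: if_splits)
  also have "\<dots> = ennreal (2 * l)" using assms by simp
  finally show ?thesis .
qed

lemma integral_exp_fejer:
  assumes "l > 0"
  shows "(LINT t|lborel. osc y t * complex_of_real (fejer l t)) = complex_of_real (tent l y)"
  using integral_iexp_even[OF integrable_fejer[OF assms] fejer_even, of "- y", unfolded mult_minus_left of_real_minus mult_minus_right]
    has_bochner_integral_fejer_cos[OF assms, of y]
  by (simp add: cos_transform_def has_bochner_integral_iff osc_def)

text \<open>
Expanding the squared modulus turns the left-hand side into the double integral of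
\<open>g(x) cnj (g(y)) tent(x - y)\<close>, because the tent is the transform of the Fejer kernel.  As the tent is
nonnegative with integral at most \<open>2 l\<close>, the bound \<open>\<bar>g(x) g(y)\<bar> \<le> (\<bar>g(x)\<bar>\<^sup>2 + \<bar>g(y)\<bar>\<^sup>2) / 2\<close> suffices.
The expansion is carried out by two applications of the multiplication formula, with \<open>y\<close> reflected.
\<close>

lemma fejer_weighted_bessel:
  assumes l: "l > 0" and g: "integrable lborel g"
  shows "(\<integral>\<^sup>+t. ennreal (fejer l t * (cmod (fourier_int g t))\<^sup>2) \<partial>lborel) \<le> ennreal (l / pi) * sq_norm g"
proof -
  have [measurable]: "g \<in> borel_measurable borel" using g by auto
  define G where "G t = (LINT x|lborel. osc t x * g x)" for t
  have [measurable]: "G \<in> borel_measurable borel" unfolding G_def by measurable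
  have [measurable]: "cnj \<in> borel_measurable borel"
    by (intro borel_measurable_continuous_onI continuous_intros)
  have fej: "integrable lborel (\<lambda>t. complex_of_real (fejer l t))"
    using integrable_fejer[OF l] by simp
  define B where "B = (LINT x|lborel. cmod (g x))"
  have GB: "cmod (G t) \<le> B" for t unfolding G_def B_def by (rule cmod_fourier_int_le)
  have int_fG: "integrable lborel (\<lambda>t. complex_of_real (fejer l t) * cnj (G t))"
  proof (rule Bochner_Integration.integrable_bound[of _ "\<lambda>t. B * fejer l t"])
    show "AE t in lborel. norm (complex_of_real (fejer l t) * cnj (G t)) \<le> norm (B * fejer l t)"
      using GB order_trans[OF norm_ge_zero GB] fejer_nonneg[OF l]
      by (intro AE_I2) (simp add: norm_mult abs_mult mult_right_mono mult.commute[of "fejer l _"])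
  qed (use integrable_fejer[OF l] in auto)
  have int_fGG: "integrable lborel (\<lambda>t. fejer l t * (cmod (G t))\<^sup>2)"
  proof (rule Bochner_Integration.integrable_bound[of _ "\<lambda>t. B\<^sup>2 * fejer l t"])
    show "AE t in lborel. norm (fejer l t * (cmod (G t))\<^sup>2) \<le> norm (B\<^sup>2 * fejer l t)"
      using power_mono[OF GB, of _ 2] fejer_nonneg[OF l]
      by (intro AE_I2) (simp add: abs_mult mult_right_mono mult.commute[of "fejer l _"])
  qed (use integrable_fejer[OF l] in auto)
  have gm: "integrable lborel (\<lambda>y. cnj (g (- y)))"
    using lborel_integrable_real_affine[OF g, of "-1" 0] by simp
  have cnjG: "cnj (G t) = (LINT y|lborel. osc t y * cnj (g (- y)))" for t
  proof -
    have "cnj (G t) = (LINT y|lborel. cnj (osc t y * g y))"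
      unfolding G_def by (rule Bochner_Integration.integral_cnj[symmetric])
    also have "\<dots> = (LINT y|lborel. cnj (osc t (0 + - 1 * y) * g (0 + - 1 * y)))"
      by (subst lborel_integral_real_affine[of "-1" _ 0]) simp_all
    finally show ?thesis by (simp add: cnj_osc)
  qed
  have "complex_of_real (LINT t|lborel. fejer l t * (cmod (G t))\<^sup>2) =
      (LINT t|lborel. (complex_of_real (fejer l t) * cnj (G t)) * G t)"
    unfolding integral_complex_of_real[symmetric] of_real_mult complex_norm_square by (simp add: mult_ac)
  also have "\<dots> = (LINT x|lborel. g x * (LINT t|lborel. osc x t * (complex_of_real (fejer l t) * cnj (G t))))"
    unfolding G_def[of t for t] by (rule fourier_multiplication[OF int_fG[unfolded G_def] g])
  also have "\<dots> = (LINT x|lborel. g x * (LINT y|lborel. cnj (g (- y)) * complex_of_real (tent l (x + y))))"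
  proof -
    have "(LINT t|lborel. osc x t * (complex_of_real (fejer l t) * cnj (G t))) =
       (LINT y|lborel. cnj (g (- y)) * complex_of_real (tent l (x + y)))" for x
    proof -
    have "(LINT t|lborel. osc x t * (complex_of_real (fejer l t) * cnj (G t))) =
       (LINT t|lborel. (osc x t * complex_of_real (fejer l t)) *
           (LINT y|lborel. osc t y * cnj (g (- y))))"
      by (simp add: cnjG mult_ac)
    also have "\<dots> = (LINT y|lborel. cnj (g (- y)) *
         (LINT t|lborel. osc y t * (osc x t * complex_of_real (fejer l t))))"
      by (rule fourier_multiplication[OF integrable_osc_times[OF fej] gm])
    also have "\<dots> = (LINT y|lborel. cnj (g (- y)) * complex_of_real (tent l (x + y)))"
    proof (intro Bochner_Integration.integral_cong refl arg_cong2[where f = "(*)"])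
      fix y
      have "osc y t * (osc x t * z) = osc (x + y) t * z" for t z
        by (simp add: mult.assoc[symmetric] osc_mult_add add.commute)
      then show "(LINT t|lborel. osc y t * (osc x t * complex_of_real (fejer l t))) = complex_of_real (tent l (x + y))"
        using integral_exp_fejer[OF l] by (simp only:)
    qed
    finally show ?thesis .
    qed
    then show ?thesis by (simp only:)
  qed
  finally have eq: "complex_of_real (LINT t|lborel. fejer l t * (cmod (G t))\<^sup>2) =
    (LINT x|lborel. g x * (LINT y|lborel. cnj (g (- y)) * complex_of_real (tent l (x + y))))" .
  have norm_le: "ennreal (cmod (LINT x|lborel. h x)) \<le> (\<integral>\<^sup>+x. ennreal (cmod (h x)) \<partial>lborel)" for h :: "real \<Rightarrow> complex"
  proof (cases "integrable lborel h")
    case True then show ?thesis by (rule integral_norm_bound_ennreal)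
  qed (simp add: not_integrable_integral_eq)
  have sqm: "(\<integral>\<^sup>+y. ennreal ((cmod (g (- y)))\<^sup>2) \<partial>lborel) = sq_norm g"
    using nn_integral_real_affine[of "\<lambda>x. ennreal ((cmod (g x))\<^sup>2)" "-1" 0] by simp
  have "(\<integral>\<^sup>+t. ennreal (fejer l t * (cmod (G t))\<^sup>2) \<partial>lborel) = ennreal (LINT t|lborel. fejer l t * (cmod (G t))\<^sup>2)"
    using fejer_nonneg[OF l] by (intro nn_integral_eq_integral int_fGG) simp
  also have "\<dots> = ennreal (cmod (complex_of_real (LINT t|lborel. fejer l t * (cmod (G t))\<^sup>2)))"
    using fejer_nonneg[OF l] by (simp add: integral_nonneg_AE)
  also have "\<dots> \<le> (\<integral>\<^sup>+x. ennreal (cmod (g x * (LINT y|lborel. cnj (g (- y)) * complex_of_real (tent l (x + y))))) \<partial>lborel)"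
    unfolding eq by (rule norm_le)
  also have "\<dots> \<le> (\<integral>\<^sup>+x. ennreal (cmod (g x)) * (\<integral>\<^sup>+y. ennreal (cmod (cnj (g (- y)) * complex_of_real (tent l (x + y)))) \<partial>lborel) \<partial>lborel)"
    unfolding norm_mult[of "g x" for x] by (subst ennreal_mult) (auto intro!: nn_integral_mono mult_left_mono norm_le)
  also have "\<dots> = (\<integral>\<^sup>+x. \<integral>\<^sup>+y. ennreal (cmod (g x) * cmod (g (- y)) * tent l (x + y)) \<partial>lborel \<partial>lborel)"
    by (subst nn_integral_cmult[symmetric]) (auto simp: norm_mult ennreal_mult mult.assoc)
  also have "\<dots> \<le> (\<integral>\<^sup>+x. \<integral>\<^sup>+y. ennreal ((cmod (g x))\<^sup>2 / 2) * ennreal (tent l (x + y)) +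
       ennreal ((cmod (g (- y)))\<^sup>2 / 2) * ennreal (tent l (x + y)) \<partial>lborel \<partial>lborel)"
  proof (intro nn_integral_mono)
    fix x y
    have "cmod (g x) * cmod (g (- y)) \<le> (cmod (g x))\<^sup>2 / 2 + (cmod (g (- y)))\<^sup>2 / 2"
      using zero_le_power2[of "cmod (g x) - cmod (g (- y))"] by (simp add: power2_eq_square algebra_simps)
    then have "cmod (g x) * cmod (g (- y)) * tent l (x + y) \<le> (cmod (g x))\<^sup>2 / 2 * tent l (x + y) + (cmod (g (- y)))\<^sup>2 / 2 * tent l (x + y)"
      unfolding distrib_right[symmetric] by (rule mult_right_mono) simp
    then show "ennreal (cmod (g x) * cmod (g (- y)) * tent l (x + y)) \<le> ennreal ((cmod (g x))\<^sup>2 / 2) * ennreal (tent l (x + y)) +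
       ennreal ((cmod (g (- y)))\<^sup>2 / 2) * ennreal (tent l (x + y))"
      by (simp flip: ennreal_mult' ennreal_plus add: ennreal_leI)
  qed
  also have "\<dots> = (\<integral>\<^sup>+x. \<integral>\<^sup>+y. ennreal ((cmod (g x))\<^sup>2 / 2) * ennreal (tent l (x + y)) \<partial>lborel \<partial>lborel) +
       (\<integral>\<^sup>+x. \<integral>\<^sup>+y. ennreal ((cmod (g (- y)))\<^sup>2 / 2) * ennreal (tent l (x + y)) \<partial>lborel \<partial>lborel)"
    by (subst nn_integral_add[symmetric]; (subst nn_integral_add[symmetric])?) auto
  also have "(\<integral>\<^sup>+x. \<integral>\<^sup>+y. ennreal ((cmod (g (- y)))\<^sup>2 / 2) * ennreal (tent l (x + y)) \<partial>lborel \<partial>lborel) =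
       (\<integral>\<^sup>+y. \<integral>\<^sup>+x. ennreal ((cmod (g (- y)))\<^sup>2 / 2) * ennreal (tent l (y + x)) \<partial>lborel \<partial>lborel)"
    by (subst lborel_pair.Fubini') (simp_all add: add.commute)
  also have "(\<integral>\<^sup>+x. \<integral>\<^sup>+y. ennreal ((cmod (g x))\<^sup>2 / 2) * ennreal (tent l (x + y)) \<partial>lborel \<partial>lborel) \<le>
       (\<integral>\<^sup>+x. ennreal ((cmod (g x))\<^sup>2 / 2) * ennreal (2 * l) \<partial>lborel)"
    by (intro nn_integral_mono) (subst nn_integral_cmult; auto intro!: mult_left_mono nn_integral_tent_le l)
  also have "(\<integral>\<^sup>+y. \<integral>\<^sup>+x. ennreal ((cmod (g (- y)))\<^sup>2 / 2) * ennreal (tent l (y + x)) \<partial>lborel \<partial>lborel) \<le>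
       (\<integral>\<^sup>+x. ennreal ((cmod (g (- x)))\<^sup>2 / 2) * ennreal (2 * l) \<partial>lborel)"
    by (intro nn_integral_mono) (subst nn_integral_cmult; auto intro!: mult_left_mono nn_integral_tent_le l)
  also have "(\<integral>\<^sup>+x. ennreal ((cmod (g x))\<^sup>2 / 2) * ennreal (2 * l) \<partial>lborel) = ennreal l * sq_norm g"
    using l by (subst nn_integral_cmult[symmetric]) (auto simp flip: ennreal_mult intro!: nn_integral_cong)
  also have "(\<integral>\<^sup>+x. ennreal ((cmod (g (- x)))\<^sup>2 / 2) * ennreal (2 * l) \<partial>lborel) = ennreal l * sq_norm g"
    using l unfolding sqm[symmetric] by (subst nn_integral_cmult[symmetric]) (auto simp flip: ennreal_mult intro!: nn_integral_cong)
  also have "ennreal l * sq_norm g + ennreal l * sq_norm g = ennreal (2 * l) * sq_norm g"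
    using l by (simp add: distrib_right[symmetric] ennreal_plus[symmetric] del: ennreal_plus)
  finally have main: "(\<integral>\<^sup>+t. ennreal (fejer l t * (cmod (G t))\<^sup>2) \<partial>lborel) \<le> ennreal (2 * l) * sq_norm g"
    by (simp add: add_mono)
  have "(\<integral>\<^sup>+t. ennreal (fejer l t * (cmod (fourier_int g t))\<^sup>2) \<partial>lborel) =
      ennreal (1 / (2 * pi)) * (\<integral>\<^sup>+t. ennreal (fejer l t * (cmod (G t))\<^sup>2) \<partial>lborel)"
  proof (subst nn_integral_cmult[symmetric])
    have "fejer l t * (cmod (fourier_int g t))\<^sup>2 = 1 / (2 * pi) * (fejer l t * (cmod (G t))\<^sup>2)" for t
      by (simp add: fourier_int_osc G_def norm_mult norm_divide power_mult_distrib power_divide)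
    then show "(\<integral>\<^sup>+t. ennreal (fejer l t * (cmod (fourier_int g t))\<^sup>2) \<partial>lborel) =
      (\<integral>\<^sup>+t. ennreal (1 / (2 * pi)) * ennreal (fejer l t * (cmod (G t))\<^sup>2) \<partial>lborel)"
      using fejer_nonneg[OF l] by (simp add: ennreal_mult[symmetric])
  qed measurable
  also have "\<dots> \<le> ennreal (1 / (2 * pi)) * (ennreal (2 * l) * sq_norm g)"
    by (intro mult_left_mono main) simp
  also have "\<dots> = ennreal (l / pi) * sq_norm g"
    using l by (simp add: mult.assoc[symmetric] ennreal_mult[symmetric])
  finally show ?thesis .
qed

text \<open>
As \<open>l\<close> tends to 0, the rescaled weights \<open>K\<^sub>l(t) / l\<close> converge to a positive constant; Fatou's lemma
removes the weight from the previous inequality.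
\<close>

lemma bessel:
  assumes g: "integrable lborel g"
  shows "sq_norm (fourier_int g) \<le> ennreal (2 * fejer_mass / pi) * sq_norm g"
proof -
  have [measurable]: "g \<in> borel_measurable borel" using g by auto
  define c where "c n t = fejer (1 / real (Suc n)) t * real (Suc n)" for n t
  have lim: "(\<lambda>n. ennreal (c n t * (cmod (fourier_int g t))\<^sup>2)) \<longlonglongrightarrow> ennreal (1 / (2 * fejer_mass) * (cmod (fourier_int g t))\<^sup>2)"
    if "t \<noteq> 0" for t
  proof -
    have "(\<lambda>n. (1 - cos (t / real (Suc n))) / (t / real (Suc n))\<^sup>2) \<longlonglongrightarrow> 1 / 2"
      using that by (real_asymp) (simp add: field_simps power2_eq_square)
    then have "(\<lambda>n. (1 - cos (t / real (Suc n))) / (t / real (Suc n))\<^sup>2 / fejer_mass) \<longlonglongrightarrow> 1 / 2 / fejer_mass"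
      by (rule tendsto_divide) (use fejer_mass_pos in auto)
    moreover have "(1 - cos (t / real (Suc n))) / (t / real (Suc n))\<^sup>2 / fejer_mass = c n t" for n
      unfolding c_def fejer_def by (simp add: power_divide power2_eq_square mult_ac)
    ultimately have "(\<lambda>n. c n t) \<longlonglongrightarrow> 1 / (2 * fejer_mass)" by simp
    then show ?thesis by (intro tendsto_ennrealI tendsto_mult_right)
  qed
  have le: "(\<integral>\<^sup>+t. ennreal (c n t * (cmod (fourier_int g t))\<^sup>2) \<partial>lborel) \<le> ennreal (1 / pi) * sq_norm g" for n
  proof -
    have "(\<integral>\<^sup>+t. ennreal (c n t * (cmod (fourier_int g t))\<^sup>2) \<partial>lborel) =
       (\<integral>\<^sup>+t. ennreal (real (Suc n)) * ennreal (fejer (1 / real (Suc n)) t * (cmod (fourier_int g t))\<^sup>2) \<partial>lborel)"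
      by (intro nn_integral_cong) (simp add: c_def ennreal_mult[symmetric] fejer_nonneg mult_ac del: of_nat_Suc)
    also have "\<dots> = ennreal (real (Suc n)) * (\<integral>\<^sup>+t. ennreal (fejer (1 / real (Suc n)) t * (cmod (fourier_int g t))\<^sup>2) \<partial>lborel)"
      by (rule nn_integral_cmult) measurable
    also have "\<dots> \<le> ennreal (real (Suc n)) * (ennreal (1 / real (Suc n) / pi) * sq_norm g)"
      by (intro mult_left_mono fejer_weighted_bessel g) simp_all
    also have "\<dots> = ennreal (1 / pi) * sq_norm g"
      by (simp add: mult.assoc[symmetric] ennreal_mult[symmetric] del: of_nat_Suc)
    finally show ?thesis .
  qed
  have "ennreal (1 / (2 * fejer_mass)) * sq_norm (fourier_int g) =
      (\<integral>\<^sup>+t. ennreal (1 / (2 * fejer_mass) * (cmod (fourier_int g t))\<^sup>2) \<partial>lborel)"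
    using fejer_mass_pos by (subst nn_integral_cmult[symmetric]) (simp_all add: ennreal_mult[symmetric])
  also have "\<dots> = (\<integral>\<^sup>+t. liminf (\<lambda>n. ennreal (c n t * (cmod (fourier_int g t))\<^sup>2)) \<partial>lborel)"
  proof (rule nn_integral_cong_AE, rule AE_mp[OF AE_lborel_singleton[of 0]], intro AE_I2 impI)
    fix t :: real assume "t \<noteq> 0"
    then show "ennreal (1 / (2 * fejer_mass) * (cmod (fourier_int g t))\<^sup>2) =
        liminf (\<lambda>n. ennreal (c n t * (cmod (fourier_int g t))\<^sup>2))"
      by (intro lim_imp_Liminf[symmetric] lim) simp_all
  qed
  also have "\<dots> \<le> liminf (\<lambda>n. \<integral>\<^sup>+t. ennreal (c n t * (cmod (fourier_int g t))\<^sup>2) \<partial>lborel)"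
    by (rule nn_integral_liminf) (simp add: c_def)
  also have "\<dots> \<le> liminf (\<lambda>n. ennreal (1 / pi) * sq_norm g)"
    by (intro Liminf_mono always_eventually allI le)
  also have "\<dots> = ennreal (1 / pi) * sq_norm g" by (simp add: Liminf_const)
  finally have "ennreal (2 * fejer_mass) * (ennreal (1 / (2 * fejer_mass)) * sq_norm (fourier_int g)) \<le>
     ennreal (2 * fejer_mass) * (ennreal (1 / pi) * sq_norm g)" by (rule mult_left_mono) simp
  then show ?thesis
    using fejer_mass_pos by (simp add: mult.assoc[symmetric] ennreal_mult[symmetric])
qed

section \<open>The Fourier transform of square integrable functions\<close>

text \<open>
The Riesz-Fischer argument: a fast subsequence converges almost everywhere, and Fatou's lemma
transfers the Cauchy bound to its limit.
\<close>

lemma L2_cauchy_limit: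
  fixes h :: "nat \<Rightarrow> real \<Rightarrow> complex" and \<tau> :: "nat \<Rightarrow> ennreal"
  assumes [measurable]: "\<And>k. h k \<in> borel_measurable borel"
    and cauchy: "\<And>k l. k \<le> l \<Longrightarrow> sq_norm (\<lambda>x. h k x - h l x) \<le> \<tau> k"
    and \<tau>: "\<tau> \<longlonglongrightarrow> 0"
  obtains H where "H \<in> borel_measurable borel" "\<And>k. sq_norm (\<lambda>x. h k x - H x) \<le> \<tau> k"
proof -
  have "\<exists>K. \<forall>k\<ge>K. \<tau> k \<le> ennreal ((1/4) ^ j)" for j
  proof -
    have "eventually (\<lambda>k. \<tau> k < ennreal ((1/4) ^ j)) sequentially"
      by (rule order_tendstoD(2)[OF \<tau>]) simp
    then show ?thesis by (auto simp: eventually_sequentially intro: less_imp_le)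
  qed
  then obtain K where K: "\<And>j k. k \<ge> K j \<Longrightarrow> \<tau> k \<le> ennreal ((1/4) ^ j)" by metis
  \<comment> \<open>The partial sums make the subsequence monotone and at least as far out as each \<open>K j\<close>.\<close>
  define r where "r j = j + (\<Sum>i\<le>j. K i)" for j
  have r_ge: "r j \<ge> K j" "r j \<ge> j" "r j \<le> r (Suc j)" for j
    unfolding r_def using member_le_sum[of j "{..j}" K] by auto
  define d where "d j x = h (r j) x - h (r (Suc j)) x" for j x
  have [measurable]: "d j \<in> borel_measurable borel" for j unfolding d_def by measurable
  \<comment> \<open>The factor \<open>2 ^ j\<close> still leaves a convergent series, and it makes the increments themselves
    summable: \<open>u \<le> 1 / 2 ^ j + 2 ^ j * u\<^sup>2\<close> for \<open>u \<ge> 0\<close>.\<close>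
  have "(\<integral>\<^sup>+x. (\<Sum>j. ennreal (2 ^ j * (cmod (d j x))\<^sup>2)) \<partial>lborel) = (\<Sum>j. \<integral>\<^sup>+x. ennreal (2 ^ j * (cmod (d j x))\<^sup>2) \<partial>lborel)"
    by (rule nn_integral_suminf) measurable
  also have "\<dots> \<le> (\<Sum>j. ennreal ((1/2) ^ j))"
  proof (intro suminf_le summableI)
    fix j
    have "(\<integral>\<^sup>+x. ennreal (2 ^ j * (cmod (d j x))\<^sup>2) \<partial>lborel) = ennreal (2 ^ j) * sq_norm (d j)"
      by (subst nn_integral_cmult[symmetric]) (simp_all add: ennreal_mult)
    also have "\<dots> \<le> ennreal (2 ^ j) * ennreal ((1/4) ^ j)"
      unfolding d_def by (intro mult_left_mono order_trans[OF cauchy K] r_ge) simp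
    also have "\<dots> = ennreal ((1/2) ^ j)"
      by (simp add: ennreal_mult[symmetric] power_mult_distrib[symmetric])
    finally show "(\<integral>\<^sup>+x. ennreal (2 ^ j * (cmod (d j x))\<^sup>2) \<partial>lborel) \<le> ennreal ((1/2) ^ j)" .
  qed
  also have "\<dots> < \<infinity>"
    by (subst suminf_ennreal2) (auto intro: summable_geometric)
  finally have "AE x in lborel. (\<Sum>j. ennreal (2 ^ j * (cmod (d j x))\<^sup>2)) \<noteq> \<infinity>"
    by (intro nn_integral_noteq_infinite) auto
  then have conv: "AE x in lborel. convergent (\<lambda>j. h (r j) x)"
  proof (rule AE_mp, intro AE_I2 impI)
    fix x assume fin: "(\<Sum>j. ennreal (2 ^ j * (cmod (d j x))\<^sup>2)) \<noteq> \<infinity>"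
    have s: "summable (\<lambda>j. 2 ^ j * (cmod (d j x))\<^sup>2)"
      by (rule summable_suminf_not_top) (use fin in auto)
    have "summable (\<lambda>j. d j x)"
    proof (rule summable_norm_cancel, rule summable_comparison_test')
      show "summable (\<lambda>j. (1/2) ^ j + 2 ^ j * (cmod (d j x))\<^sup>2 :: real)"
        by (intro summable_add s summable_geometric) simp
      fix j
      let ?a = "cmod (d j x)"
      have "0 \<le> (2 ^ j * ?a - 1)\<^sup>2 + 2 ^ j * ?a" by simp
      then have "2 ^ j * ?a \<le> 1 + 2 ^ j * (2 ^ j * ?a\<^sup>2)" by (simp add: power2_eq_square algebra_simps)
      then have "(1/2) ^ j * (2 ^ j * ?a) \<le> (1/2) ^ j * (1 + 2 ^ j * (2 ^ j * ?a\<^sup>2))"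
        by (rule mult_left_mono) simp
      then show "norm (norm (d j x)) \<le> (1/2) ^ j + 2 ^ j * ?a\<^sup>2"
        by (simp add: algebra_simps power_divide)
    qed
    then have "convergent (\<lambda>n. \<Sum>j<n. d j x)" by (simp add: summable_iff_convergent)
    then have "convergent (\<lambda>n. h (r 0) x - (\<Sum>j<n. d j x))" by (intro convergent_diff convergent_const)
    moreover have "h (r 0) x - (\<Sum>j<n. d j x) = h (r n) x" for n
      by (induction n) (simp_all add: d_def algebra_simps)
    ultimately show "convergent (\<lambda>j. h (r j) x)" by simp
  qed
  define H where "H x = lim (\<lambda>j. h (r j) x)" for x
  have [measurable]: "H \<in> borel_measurable borel"
    unfolding H_def by (rule borel_measurable_lim_metric) measurable
  have "sq_norm (\<lambda>x. h k x - H x) \<le> \<tau> k" for k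
  proof -
    have "sq_norm (\<lambda>x. h k x - H x) = (\<integral>\<^sup>+x. liminf (\<lambda>j. ennreal ((cmod (h k x - h (r j) x))\<^sup>2)) \<partial>lborel)"
    proof (rule nn_integral_cong_AE, use conv in \<open>rule AE_mp\<close>, intro AE_I2 impI)
      fix x assume "convergent (\<lambda>j. h (r j) x)"
      then have "(\<lambda>j. h (r j) x) \<longlonglongrightarrow> H x" by (simp add: H_def convergent_LIMSEQ_iff)
      then have "(\<lambda>j. ennreal ((cmod (h k x - h (r j) x))\<^sup>2)) \<longlonglongrightarrow> ennreal ((cmod (h k x - H x))\<^sup>2)"
        by (intro tendsto_ennrealI tendsto_intros)
      then show "ennreal ((cmod (h k x - H x))\<^sup>2) = liminf (\<lambda>j. ennreal ((cmod (h k x - h (r j) x))\<^sup>2))"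
        by (rule lim_imp_Liminf[symmetric, rotated]) simp
    qed
    also have "\<dots> \<le> liminf (\<lambda>j. sq_norm (\<lambda>x. h k x - h (r j) x))"
      by (rule nn_integral_liminf) measurable
    also have "\<dots> \<le> liminf (\<lambda>j. \<tau> k)"
    proof (rule Liminf_mono)
      show "\<forall>\<^sub>F j in sequentially. sq_norm (\<lambda>x. h k x - h (r j) x) \<le> \<tau> k"
        using eventually_ge_at_top[of k]
        by eventually_elim (intro cauchy, use r_ge(2) le_trans in blast)
    qed
    finally show ?thesis by (simp add: Liminf_const)
  qed
  then show ?thesis by (intro that[of H]) simp_all
qed

definition trunc :: "nat \<Rightarrow> (real \<Rightarrow> complex) \<Rightarrow> real \<Rightarrow> complex" where
  "trunc k u x = indicator {- real k..real k} x * u x"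

lemma trunc_measurable [measurable]:
  "u \<in> borel_measurable borel \<Longrightarrow> trunc k u \<in> borel_measurable borel"
  unfolding trunc_def by measurable

lemma integrable_trunc:
  assumes "u \<in> L2"
  shows "integrable lborel (trunc k u)"
proof (rule Bochner_Integration.integrable_bound)
  have [measurable]: "u \<in> borel_measurable borel" using assms by (simp add: L2_def)
  show "integrable lborel (\<lambda>x. indicator {- real k..real k} x + (cmod (u x))\<^sup>2)"
    using assms by (intro Bochner_Integration.integrable_add integrable_real_indicator) (auto simp: L2_def)
  show "AE x in lborel. norm (trunc k u x) \<le> norm (indicator {- real k..real k} x + (cmod (u x))\<^sup>2)"
  proof (rule AE_I2)
    fix x
    have "0 \<le> (cmod (u x) - 1)\<^sup>2 + cmod (u x)" by simp
    then have "cmod (u x) \<le> 1 + (cmod (u x))\<^sup>2" by (simp add: power2_eq_square algebra_simps)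
    then show "norm (trunc k u x) \<le> norm (indicator {- real k..real k} x + (cmod (u x))\<^sup>2)"
      by (auto simp: trunc_def indicator_def norm_mult)
  qed
  show "trunc k u \<in> borel_measurable lborel" by simp
qed

text \<open>
The Bessel bound for the squared distance between the transforms of \<open>u\<close> and of its truncation to \<open>[-k, k]\<close>.
\<close>

definition L2_tail :: "(real \<Rightarrow> complex) \<Rightarrow> nat \<Rightarrow> ennreal" where
  "L2_tail u k = ennreal (2 * fejer_mass / pi) * (\<integral>\<^sup>+x. indicator (- {- real k..real k}) x * ennreal ((cmod (u x))\<^sup>2) \<partial>lborel)"

lemma L2_tail_tendsto_0:
  assumes "u \<in> L2"
  shows "L2_tail u \<longlonglongrightarrow> 0"
proof -
  have [measurable]: "u \<in> borel_measurable borel" and fin: "sq_norm u < \<infinity>" using assms by (auto simp: L2_iff)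
  have "(\<lambda>k::nat. \<integral>\<^sup>+x. indicator (- {- real k..real k}) x * ennreal ((cmod (u x))\<^sup>2) \<partial>lborel) \<longlonglongrightarrow> (\<integral>\<^sup>+x. 0 \<partial>(lborel :: real measure))"
  proof (rule nn_integral_dominated_convergence[where w = "\<lambda>x. ennreal ((cmod (u x))\<^sup>2)"])
    show "AE x in lborel. (\<lambda>k::nat. indicator (- {- real k..real k}) x * ennreal ((cmod (u x))\<^sup>2)) \<longlonglongrightarrow> 0"
    proof (intro AE_I2 tendsto_eventually)
      fix x :: real
      obtain K :: nat where "\<bar>x\<bar> \<le> real K" using real_arch_simple by blast
      then show "\<forall>\<^sub>F k in sequentially. indicator (- {- real k..real k}) x * ennreal ((cmod (u x))\<^sup>2) = 0"
        by (intro eventually_sequentiallyI[of K]) (auto simp: indicator_def)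
    qed
  qed (use fin in \<open>auto simp: indicator_def\<close>)
  then have "(\<lambda>k::nat. ennreal (2 * fejer_mass / pi) * (\<integral>\<^sup>+x. indicator (- {- real k..real k}) x * ennreal ((cmod (u x))\<^sup>2) \<partial>lborel)) \<longlonglongrightarrow>
    ennreal (2 * fejer_mass / pi) * (\<integral>\<^sup>+x. 0 \<partial>(lborel :: real measure))"
    by (intro ennreal_tendsto_cmult) auto
  then show ?thesis unfolding L2_tail_def by simp
qed

lemma fourier_trunc_cauchy:
  assumes u: "u \<in> L2" and kl: "k \<le> l"
  shows "sq_norm (\<lambda>t. fourier_int (trunc k u) t - fourier_int (trunc l u) t) \<le> L2_tail u k"
proof -
  have "sq_norm (\<lambda>t. fourier_int (trunc k u) t - fourier_int (trunc l u) t) =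
      sq_norm (fourier_int (\<lambda>x. trunc k u x - trunc l u x))"
    by (simp add: fourier_int_diff integrable_trunc u)
  also have "\<dots> \<le> ennreal (2 * fejer_mass / pi) * sq_norm (\<lambda>x. trunc k u x - trunc l u x)"
    by (intro bessel Bochner_Integration.integrable_diff integrable_trunc u)
  also have "\<dots> \<le> L2_tail u k"
    unfolding L2_tail_def using kl
    by (intro mult_left_mono nn_integral_mono) (auto simp: trunc_def indicator_def)
  finally show ?thesis .
qed

text \<open>
On \<open>L2\<close> the transform is the limit in the mean of the transforms of the truncations.  For an integrable
function the integral itself is that limit; otherwise the limit exists by completeness, so that the
choice in the definition of \<open>fourier\<close> is not vacuous.
\<close>

lemma fourier_L2_limit:
  assumes u: "u \<in> L2"
  shows "fourier u \<in> L2" and "(\<lambda>k. sq_norm (\<lambda>t. fourier_int (trunc k u) t - fourier u t)) \<longlonglongrightarrow> 0"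
proof -
  have [measurable]: "u \<in> borel_measurable borel" and fin: "sq_norm u < \<infinity>" using u by (auto simp: L2_iff)
  have "fourier u \<in> L2 \<and> (\<lambda>k. sq_norm (\<lambda>t. fourier_int (trunc k u) t - fourier u t)) \<longlonglongrightarrow> 0"
  proof (cases "integrable lborel u")
    case int: True
    have "sq_norm (fourier_int u) \<le> ennreal (2 * fejer_mass / pi) * sq_norm u" by (rule bessel[OF int])
    also have "\<dots> < \<infinity>" using fin by (simp add: ennreal_mult_less_top)
    finally have "fourier_int u \<in> L2" by (simp add: L2_iff)
    moreover have "sq_norm (\<lambda>t. fourier_int (trunc k u) t - fourier_int u t) \<le> L2_tail u k" for k
    proof -
      have "sq_norm (\<lambda>t. fourier_int (trunc k u) t - fourier_int u t) =
          sq_norm (fourier_int (\<lambda>x. trunc k u x - u x))"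
        by (simp add: fourier_int_diff integrable_trunc u int)
      also have "\<dots> \<le> ennreal (2 * fejer_mass / pi) * sq_norm (\<lambda>x. trunc k u x - u x)"
        by (intro bessel Bochner_Integration.integrable_diff integrable_trunc u int)
      also have "\<dots> \<le> L2_tail u k"
        unfolding L2_tail_def
        by (intro mult_left_mono nn_integral_mono) (auto simp: trunc_def indicator_def)
      finally show ?thesis .
    qed
    then have "(\<lambda>k. sq_norm (\<lambda>t. fourier_int (trunc k u) t - fourier_int u t)) \<longlonglongrightarrow> 0"
      by (intro tendsto_sandwich[OF _ _ tendsto_const L2_tail_tendsto_0[OF u]]) auto
    ultimately show ?thesis using int by (simp add: fourier_def)
  next
    case False
    obtain H where [measurable]: "H \<in> borel_measurable borel"
      and H: "\<And>k. sq_norm (\<lambda>t. fourier_int (trunc k u) t - H t) \<le> L2_tail u k"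
    proof (rule L2_cauchy_limit)
      show "fourier_int (trunc k u) \<in> borel_measurable borel" for k by measurable
      show "sq_norm (\<lambda>t. fourier_int (trunc k u) t - fourier_int (trunc l u) t) \<le> L2_tail u k" if "k \<le> l" for k l
        by (rule fourier_trunc_cauchy[OF u that])
      show "L2_tail u \<longlonglongrightarrow> 0" by (rule L2_tail_tendsto_0[OF u])
    qed blast
    have lim: "(\<lambda>k. sq_norm (\<lambda>t. fourier_int (trunc k u) t - H t)) \<longlonglongrightarrow> 0"
      by (rule tendsto_sandwich[OF _ _ tendsto_const L2_tail_tendsto_0[OF u]]) (simp_all add: H)
    \<comment> \<open>Truncation to the single point 0 leaves a null function, so the bound for \<open>k = 0\<close> shows that the
      limit is square integrable.\<close>
    have "fourier_int (trunc 0 u) t = 0" for t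
    proof -
      have "(LINT x|lborel. osc t x * trunc 0 u x) = (LINT x|(lborel :: real measure). 0)"
      proof (rule integral_cong_AE)
        show "AE x in lborel. osc t x * trunc 0 u x = 0"
          by (rule AE_mp[OF AE_lborel_singleton[of 0]]) (auto simp: trunc_def indicator_def)
      qed simp_all
      then show ?thesis by (simp add: fourier_int_osc)
    qed
    then have "sq_norm H \<le> L2_tail u 0" using H[of 0] by simp
    also have "L2_tail u 0 \<le> ennreal (2 * fejer_mass / pi) * sq_norm u"
      unfolding L2_tail_def by (intro mult_left_mono nn_integral_mono) (auto simp: indicator_def)
    also have "\<dots> < \<infinity>" using fin by (simp add: ennreal_mult_less_top)
    finally have "H \<in> L2" by (simp add: L2_iff)
    with lim have "\<exists>h. h \<in> L2 \<and> (\<lambda>k. sq_norm (\<lambda>t. fourier_int (trunc k u) t - h t)) \<longlonglongrightarrow> 0" by blast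
    from someI_ex[OF this] False show ?thesis
      unfolding fourier_def trunc_def by simp
  qed
  then show "fourier u \<in> L2" and "(\<lambda>k. sq_norm (\<lambda>t. fourier_int (trunc k u) t - fourier u t)) \<longlonglongrightarrow> 0"
    by auto
qed

section \<open>Integrals of the transform over a frequency band\<close>

definition band :: "real \<Rightarrow> real \<Rightarrow> (real \<Rightarrow> complex) \<Rightarrow> complex" where
  "band a b v = (LINT t|lborel. indicator {a..b} t * v t)"

text \<open>
The Cauchy-Schwarz inequality against the indicator of the band.
\<close>

lemma cmod_band_sq_le:
  assumes [measurable]: "v \<in> borel_measurable borel" and "a \<le> b"
  shows "ennreal ((cmod (band a b v))\<^sup>2) \<le> ennreal (b - a) * (\<integral>\<^sup>+t. indicator {a..b} t * ennreal ((cmod (v t))\<^sup>2) \<partial>lborel)"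
proof -
  have "ennreal (cmod (band a b v)) \<le> (\<integral>\<^sup>+t. ennreal (cmod (indicator {a..b} t * v t)) \<partial>lborel)"
  proof (cases "integrable lborel (\<lambda>t. indicator {a..b} t * v t)")
    case True then show ?thesis unfolding band_def by (rule integral_norm_bound_ennreal)
  qed (simp add: band_def not_integrable_integral_eq)
  also have "\<dots> = (\<integral>\<^sup>+t. indicator {a..b} t * (indicator {a..b} t * ennreal (cmod (v t))) \<partial>lborel)"
    by (intro nn_integral_cong) (auto simp: indicator_def)
  finally have "(ennreal (cmod (band a b v)))\<^sup>2 \<le> (\<integral>\<^sup>+t. indicator {a..b} t * (indicator {a..b} t * ennreal (cmod (v t))) \<partial>lborel)\<^sup>2"
    by (intro power_mono) auto
  also have "\<dots> \<le> (\<integral>\<^sup>+t. (indicator {a..b} t)\<^sup>2 \<partial>lborel) * (\<integral>\<^sup>+t. (indicator {a..b} t * ennreal (cmod (v t)))\<^sup>2 \<partial>lborel)"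
    by (rule Cauchy_Schwarz_nn_integral) measurable
  also have "(\<integral>\<^sup>+t. (indicator {a..b} t)\<^sup>2 \<partial>lborel) = (\<integral>\<^sup>+t. indicator {a..b} t \<partial>lborel)"
    by (intro nn_integral_cong) (auto simp: indicator_def)
  also have "\<dots> = ennreal (b - a)" using assms(2) by simp
  also have "(\<integral>\<^sup>+t. (indicator {a..b} t * ennreal (cmod (v t)))\<^sup>2 \<partial>lborel) = (\<integral>\<^sup>+t. indicator {a..b} t * ennreal ((cmod (v t))\<^sup>2) \<partial>lborel)"
    by (intro nn_integral_cong) (auto simp: indicator_def ennreal_power)
  finally show ?thesis by (simp add: ennreal_power)
qed

lemma integrable_band:
  assumes "v \<in> L2"
  shows "integrable lborel (\<lambda>t. indicator {a..b} t * v t)"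
proof -
  obtain k :: nat where k: "\<bar>a\<bar> + \<bar>b\<bar> \<le> real k" using real_arch_simple by blast
  have [measurable]: "v \<in> borel_measurable borel" using assms by (simp add: L2_def)
  show ?thesis
    by (rule Bochner_Integration.integrable_bound[OF integrable_trunc[OF assms, of k]])
       (use k in \<open>auto simp: trunc_def indicator_def\<close>)
qed

lemma band_diff:
  assumes "v \<in> L2" "w \<in> L2"
  shows "band a b (\<lambda>t. v t - w t) = band a b v - band a b w"
  unfolding band_def using integrable_band[OF assms(1)] integrable_band[OF assms(2)]
  by (simp add: right_diff_distrib)

lemma fourier_int_trunc_L2:
  assumes u: "u \<in> L2"
  shows "fourier_int (trunc k u) \<in> L2"
proof -
  have [measurable]: "u \<in> borel_measurable borel" and fin: "sq_norm u < \<infinity>" using u by (auto simp: L2_iff)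
  have "sq_norm (fourier_int (trunc k u)) \<le> ennreal (2 * fejer_mass / pi) * sq_norm (trunc k u)"
    by (rule bessel[OF integrable_trunc[OF u]])
  also have "\<dots> \<le> ennreal (2 * fejer_mass / pi) * sq_norm u"
    by (intro mult_left_mono nn_integral_mono) (auto simp: trunc_def indicator_def)
  also have "\<dots> < \<infinity>" using fin by (simp add: ennreal_mult_less_top)
  finally show ?thesis by (simp add: L2_iff)
qed

lemma band_fourier_int_trunc_tendsto:
  assumes u: "u \<in> L2" and ab: "a \<le> b"
  shows "(\<lambda>k. band a b (fourier_int (trunc k u))) \<longlonglongrightarrow> band a b (fourier u)"
proof -
  note F = fourier_L2_limit[OF u]
  have [measurable]: "fourier u \<in> borel_measurable borel" "u \<in> borel_measurable borel"
    using F(1) u by (auto simp: L2_def)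
  have "(\<lambda>k. ennreal ((cmod (band a b (fourier_int (trunc k u)) - band a b (fourier u)))\<^sup>2)) \<longlonglongrightarrow> 0"
  proof (rule tendsto_sandwich[OF _ _ tendsto_const])
    show "(\<lambda>k. ennreal (b - a) * sq_norm (\<lambda>t. fourier_int (trunc k u) t - fourier u t)) \<longlonglongrightarrow> 0"
      using ennreal_tendsto_cmult[OF _ F(2), of "ennreal (b - a)"] by simp
    show "\<forall>\<^sub>F k in sequentially. ennreal ((cmod (band a b (fourier_int (trunc k u)) - band a b (fourier u)))\<^sup>2)
        \<le> ennreal (b - a) * sq_norm (\<lambda>t. fourier_int (trunc k u) t - fourier u t)"
    proof (intro always_eventually allI)
      fix k
      have "ennreal ((cmod (band a b (fourier_int (trunc k u)) - band a b (fourier u)))\<^sup>2) =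
          ennreal ((cmod (band a b (\<lambda>t. fourier_int (trunc k u) t - fourier u t)))\<^sup>2)"
        by (simp add: band_diff fourier_int_trunc_L2 u F)
      also have "\<dots> \<le> ennreal (b - a) * (\<integral>\<^sup>+t. indicator {a..b} t * ennreal ((cmod (fourier_int (trunc k u) t - fourier u t))\<^sup>2) \<partial>lborel)"
        by (intro cmod_band_sq_le ab) measurable
      also have "\<dots> \<le> ennreal (b - a) * sq_norm (\<lambda>t. fourier_int (trunc k u) t - fourier u t)"
        by (intro mult_left_mono nn_integral_mono) (auto simp: indicator_def)
      finally show "ennreal ((cmod (band a b (fourier_int (trunc k u)) - band a b (fourier u)))\<^sup>2)
        \<le> ennreal (b - a) * sq_norm (\<lambda>t. fourier_int (trunc k u) t - fourier u t)" .
    qed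
  qed auto
  then have "(\<lambda>k. (cmod (band a b (fourier_int (trunc k u)) - band a b (fourier u)))\<^sup>2) \<longlonglongrightarrow> 0"
    by (simp flip: ennreal_0 add: tendsto_ennreal_iff)
  then have "(\<lambda>k. sqrt ((cmod (band a b (fourier_int (trunc k u)) - band a b (fourier u)))\<^sup>2)) \<longlonglongrightarrow> sqrt 0"
    by (rule tendsto_real_sqrt)
  then show ?thesis by (simp add: tendsto_norm_zero_iff flip: Lim_null)
qed

text \<open>
The transform is linear on truncations, which are integrable; the limit in the mean carries this over to
the integral over a bounded band.
\<close>

lemma band_fourier_diff:
  assumes u: "u \<in> L2" and v: "v \<in> L2" and ab: "a \<le> b"
  shows "band a b (fourier (\<lambda>x. u x - v x)) = band a b (fourier u) - band a b (fourier v)"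
proof (rule LIMSEQ_unique)
  show "(\<lambda>k. band a b (fourier_int (trunc k (\<lambda>x. u x - v x)))) \<longlonglongrightarrow> band a b (fourier (\<lambda>x. u x - v x))"
    by (intro band_fourier_int_trunc_tendsto L2_diff u v ab)
  have "trunc k (\<lambda>x. u x - v x) = (\<lambda>x. trunc k u x - trunc k v x)" for k
    by (simp add: trunc_def fun_eq_iff right_diff_distrib)
  moreover have "fourier_int (\<lambda>x. trunc k u x - trunc k v x) = (\<lambda>t. fourier_int (trunc k u) t - fourier_int (trunc k v) t)" for k
    by (simp add: fun_eq_iff fourier_int_diff integrable_trunc u v)
  ultimately have "band a b (fourier_int (trunc k (\<lambda>x. u x - v x))) = band a b (fourier_int (trunc k u)) - band a b (fourier_int (trunc k v))" for k
    by (simp add: band_diff fourier_int_trunc_L2 u v)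
  then show "(\<lambda>k. band a b (fourier_int (trunc k (\<lambda>x. u x - v x)))) \<longlonglongrightarrow> band a b (fourier u) - band a b (fourier v)"
    using tendsto_diff[OF band_fourier_int_trunc_tendsto[OF u ab] band_fourier_int_trunc_tendsto[OF v ab]] by simp
qed

lemma band_fourier_le_sobolev:
  assumes u: "u \<in> L2" and ab: "0 \<le> a" "a \<le> b" and s: "0 \<le> s"
  shows "ennreal ((1 + a\<^sup>2) powr s * (cmod (band a b (fourier u)))\<^sup>2) \<le> ennreal (b - a) * sobolev_norm2 s u"
proof -
  have [measurable]: "fourier u \<in> borel_measurable borel"
    using fourier_L2_limit[OF u] by (auto simp: L2_def)
  have "ennreal ((1 + a\<^sup>2) powr s * (cmod (band a b (fourier u)))\<^sup>2) =
      ennreal ((1 + a\<^sup>2) powr s) * ennreal ((cmod (band a b (fourier u)))\<^sup>2)" by (simp add: ennreal_mult)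
  also have "\<dots> \<le> ennreal ((1 + a\<^sup>2) powr s) * (ennreal (b - a) * (\<integral>\<^sup>+t. indicator {a..b} t * ennreal ((cmod (fourier u t))\<^sup>2) \<partial>lborel))"
    by (intro mult_left_mono cmod_band_sq_le ab) auto
  also have "\<dots> = ennreal (b - a) * (\<integral>\<^sup>+t. ennreal ((1 + a\<^sup>2) powr s) * (indicator {a..b} t * ennreal ((cmod (fourier u t))\<^sup>2)) \<partial>lborel)"
    by (subst nn_integral_cmult) (auto simp: mult_ac)
  also have "\<dots> \<le> ennreal (b - a) * sobolev_norm2 s u"
    unfolding sobolev_norm2_def
  proof (intro mult_left_mono nn_integral_mono)
    fix t :: real
    show "ennreal ((1 + a\<^sup>2) powr s) * (indicator {a..b} t * ennreal ((cmod (fourier u t))\<^sup>2)) \<le>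
       ennreal ((1 + t\<^sup>2) powr s * (cmod (fourier u t))\<^sup>2)"
    proof (cases "t \<in> {a..b}")
      case True
      then have "(1 + a\<^sup>2) powr s \<le> (1 + t\<^sup>2) powr s"
        using ab s by (intro powr_mono2) (auto intro!: power_mono add_nonneg_nonneg)
      then show ?thesis using True
        by (auto simp: ennreal_mult[symmetric] intro!: ennreal_leI mult_right_mono)
    qed simp
  qed simp
  finally show ?thesis .
qed

section \<open>The two-point bound\<close>

lemma sets_sample_space_product:
  assumes "real_distribution P" "real_distribution Q"
  shows "sets (PiM {..<n} (\<lambda>_. P) \<Otimes>\<^sub>M PiM {..<m} (\<lambda>_. Q)) = sets (sample_space n m)"
  unfolding sample_space_def
  by (intro sets_pair_measure_cong sets_PiM_cong refl)
     (use assms in \<open>auto simp: real_distribution_def real_distribution_axioms_def\<close>)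

text \<open>
The transform of the estimate is only chosen up to null sets, separately for each data point.  Its
integral over a band is nevertheless measurable in the data, as the limit of the same integrals for
the truncated estimates, which are parametrised integrals.
\<close>

lemma band_estimator_measurable:
  assumes T: "T \<in> estimators n m" and ab: "a \<le> b"
  shows "(\<lambda>\<omega>. band a b (fourier (T \<omega>))) \<in> borel_measurable (sample_space n m)"
proof (rule borel_measurable_LIMSEQ_metric)
  fix \<omega> assume "\<omega> \<in> space (sample_space n m)"
  then have "T \<omega> \<in> L2" using T by (auto simp: estimators_def)
  then show "(\<lambda>k. band a b (fourier_int (trunc k (T \<omega>)))) \<longlonglongrightarrow> band a b (fourier (T \<omega>))"
    by (rule band_fourier_int_trunc_tendsto) (rule ab)
next
  fix k
  have T': "(\<lambda>(\<omega>, x). T \<omega> x) \<in> borel_measurable (sample_space n m \<Otimes>\<^sub>M borel)"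
    using T by (auto simp: estimators_def)
  have [measurable (raw)]: "(\<lambda>z. T (f z) (g z)) \<in> borel_measurable M"
    if "f \<in> measurable M (sample_space n m)" "g \<in> borel_measurable M" for f g and M :: "'x measure"
    using measurable_compose[OF measurable_Pair[OF that] T'] by simp
  show "(\<lambda>\<omega>. band a b (fourier_int (trunc k (T \<omega>)))) \<in> borel_measurable (sample_space n m)"
    unfolding band_def fourier_int_osc trunc_def by measurable
qed

text \<open>
Both experiments contain the law \<open>\<nu>\<close> of independent samples from \<open>P\<close> and \<open>Q\<close> with weight at least \<open>1/2\<close>.
On \<open>\<nu>\<close> the two losses add up to at least a multiple of the squared distance, since the estimate cannot
be close to both signals.
\<close>

lemma two_point_risk:
  assumes T: "T \<in> estimators n m"
    and f: "f0 \<in> even_densities" "f1 \<in> even_densities" and e: "e0 \<in> even_densities" "e1 \<in> even_densities"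
    and P: "real_distribution P" and Q: "real_distribution Q"
    and Y: "dominates cY (law f0 \<star> law e0) P" "dominates cY (law f1 \<star> law e1) P" "0 \<le> cY"
    and E: "dominates cE (law e0) Q" "dominates cE (law e1) Q" "0 \<le> cE"
    and c: "1 / 2 \<le> cY ^ n * cE ^ m"
    and ab: "0 \<le> a" "a < b" and s: "0 \<le> s"
  shows "ennreal ((1 + a\<^sup>2) powr s / (4 * (b - a)) * (cmod (band a b (fourier (cfun f1)) - band a b (fourier (cfun f0))))\<^sup>2)
    \<le> risk s n m T f0 e0 + risk s n m T f1 e1"
proof -
  interpret P: real_distribution P by fact
  interpret Q: real_distribution Q by fact
  let ?z = "\<lambda>f. band a b (fourier (cfun f))"
  define K where "K = (1 + a\<^sup>2) powr s / (b - a)"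
  have K: "K \<ge> 0" using ab by (simp add: K_def)
  define \<nu> where "\<nu> = PiM {..<n} (\<lambda>_. P) \<Otimes>\<^sub>M PiM {..<m} (\<lambda>_. Q)"
  have [measurable_cong]: "sets \<nu> = sets (sample_space n m)"
    unfolding \<nu>_def by (rule sets_sample_space_product[OF P Q])
  interpret PP: prob_space "PiM {..<n} (\<lambda>_. P)" by (intro prob_space_PiM P.prob_space_axioms)
  interpret PQ: prob_space "PiM {..<m} (\<lambda>_. Q)" by (intro prob_space_PiM Q.prob_space_axioms)
  interpret PPQ: pair_prob_space "PiM {..<n} (\<lambda>_. P)" "PiM {..<m} (\<lambda>_. Q)" ..
  \<comment> \<open>A measurable lower bound of the loss; the integrals of the two losses can be added only after
    passing to measurable functions.\<close>
  define G where "G f \<omega> = ennreal (K * (cmod (band a b (fourier (T \<omega>)) - ?z f))\<^sup>2)" for f \<omega>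
  have G_meas [measurable]: "G f \<in> borel_measurable (sample_space n m)" for f
  proof -
    note [measurable] = band_estimator_measurable[OF T less_imp_le[OF ab(2)]]
    show ?thesis unfolding G_def by measurable
  qed
  have risk_ge: "ennreal (cY ^ n * cE ^ m) * (\<integral>\<^sup>+\<omega>. G f \<omega> \<partial>\<nu>) \<le> risk s n m T f e"
    if "f \<in> even_densities" "e \<in> even_densities" "dominates cY (law f \<star> law e) P" "dominates cE (law e) Q" for f e
  proof -
    have rY: "real_distribution (law f \<star> law e)" and rE: "real_distribution (law e)"
      using that by (auto intro!: real_distribution_convolution real_distribution_law)
    have "dominates (cY ^ n * cE ^ m) (sample_law n m f e) \<nu>"
      unfolding sample_law_def \<nu>_def
      using that Y(3) E(3) rY rE P Q
      by (intro dominates_pair dominates_PiM prob_space_PiM) (auto simp: real_distribution_def)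
    then have "ennreal (cY ^ n * cE ^ m) * (\<integral>\<^sup>+\<omega>. G f \<omega> \<partial>\<nu>) \<le> (\<integral>\<^sup>+\<omega>. G f \<omega> \<partial>sample_law n m f e)"
      by (auto simp: dominates_def)
    also have "\<dots> \<le> risk s n m T f e"
      unfolding risk_def
    proof (rule nn_integral_mono)
      fix \<omega> assume "\<omega> \<in> space (sample_law n m f e)"
      moreover have "sets (sample_law n m f e) = sets (sample_space n m)"
        unfolding sample_law_def by (rule sets_sample_space_product[OF rY rE])
      ultimately have "\<omega> \<in> space (sample_space n m)" by (metis sets_eq_imp_space_eq)
      then have L2: "T \<omega> \<in> L2" "cfun f \<in> L2"
        using T that by (auto simp: estimators_def dest: even_densitiesD)
      have "ennreal (b - a) * G f \<omega> = ennreal ((1 + a\<^sup>2) powr s * (cmod (band a b (fourier (\<lambda>x. T \<omega> x - cfun f x))))\<^sup>2)"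
        using ab unfolding G_def K_def
        by (simp add: ennreal_mult[symmetric] band_fourier_diff[OF L2])
      also have "\<dots> \<le> ennreal (b - a) * sobolev_norm2 s (\<lambda>x. T \<omega> x - cfun f x)"
        using ab by (intro band_fourier_le_sobolev L2_diff L2 s) auto
      finally have "ennreal (1 / (b - a)) * (ennreal (b - a) * G f \<omega>) \<le> ennreal (1 / (b - a)) * (ennreal (b - a) * sobolev_norm2 s (\<lambda>x. T \<omega> x - cfun f x))"
        by (rule mult_left_mono) simp
      then show "G f \<omega> \<le> sobolev_norm2 s (\<lambda>x. T \<omega> x - cfun f x)"
        using ab by (simp add: mult.assoc[symmetric] ennreal_mult[symmetric])
    qed
    finally show ?thesis .
  qed
  define D where "D = K / 2 * (cmod (?z f1 - ?z f0))\<^sup>2"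
  have "ennreal ((1 + a\<^sup>2) powr s / (4 * (b - a)) * (cmod (?z f1 - ?z f0))\<^sup>2) = ennreal (1 / 2) * ennreal D"
  proof -
    have "(1 + a\<^sup>2) powr s / (4 * (b - a)) * (cmod (?z f1 - ?z f0))\<^sup>2 = 1 / 2 * D"
      by (simp add: D_def K_def)
    then show ?thesis by (simp only: ennreal_mult')
  qed
  also have "\<dots> \<le> ennreal (cY ^ n * cE ^ m) * ennreal D"
    by (intro mult_right_mono ennreal_leI c) simp
  also have "ennreal D = (\<integral>\<^sup>+\<omega>. ennreal D \<partial>\<nu>)"
    unfolding \<nu>_def by (simp add: PPQ.emeasure_space_1)
  also have "\<dots> \<le> (\<integral>\<^sup>+\<omega>. G f0 \<omega> + G f1 \<omega> \<partial>\<nu>)"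
  proof (rule nn_integral_mono)
    fix \<omega>
    let ?x = "band a b (fourier (T \<omega>)) - ?z f0" and ?y = "band a b (fourier (T \<omega>)) - ?z f1"
    have "(cmod (?z f1 - ?z f0))\<^sup>2 \<le> 2 * (cmod ?x)\<^sup>2 + 2 * (cmod ?y)\<^sup>2"
      using cmod_diff_sq_le[of ?x ?y] by simp
    then have "K / 2 * (cmod (?z f1 - ?z f0))\<^sup>2 \<le> K / 2 * (2 * (cmod ?x)\<^sup>2 + 2 * (cmod ?y)\<^sup>2)"
      using K by (intro mult_left_mono) auto
    then show "ennreal D \<le> G f0 \<omega> + G f1 \<omega>"
      using K unfolding D_def G_def by (simp add: ennreal_plus[symmetric] ennreal_leI algebra_simps del: ennreal_plus)
  qed
  also have "\<dots> = (\<integral>\<^sup>+\<omega>. G f0 \<omega> \<partial>\<nu>) + (\<integral>\<^sup>+\<omega>. G f1 \<omega> \<partial>\<nu>)"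
    by (rule nn_integral_add) measurable
  finally show ?thesis
    using add_mono[OF risk_ge[OF f(1) e(1) Y(1) E(1)] risk_ge[OF f(2) e(2) Y(2) E(2)]]
    by (auto simp: distrib_left mult_left_mono intro: order_trans)
qed

section \<open>Supersmooth noise of every order\<close>

text \<open>
The prescribed tail sums of the noise weights.
\<close>

definition decay :: "real \<Rightarrow> nat \<Rightarrow> real" where
  "decay a j = exp (- (real j powr (2 * a)))"

definition decay_weight :: "real \<Rightarrow> nat \<Rightarrow> real" where
  "decay_weight a j = decay a j - decay a (Suc j)"

definition tail_weight :: "real \<Rightarrow> nat \<Rightarrow> nat \<Rightarrow> real" where
  "tail_weight a i j = (if j < i then 0 else decay_weight a j)"

lemma decay_pos: "decay a j > 0" by (simp add: decay_def)

lemma decay_0: "decay a 0 = 1" by (simp add: decay_def)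

text \<open>
Weights within a factor 2 of the prescribed ones, so that original and perturbed noise are supersmooth
for the same reason.
\<close>

definition comparable_weights :: "real \<Rightarrow> (nat \<Rightarrow> real) set" where
  "comparable_weights a = {w. w sums 1 \<and> (\<forall>j. decay_weight a j / 2 \<le> w j \<and> w j \<le> 2 * decay_weight a j)}"

text \<open>
On \<open>[-1, 1]\<close> every tent is affine and \<open>\<Sum>j. w\<^sub>j tent\<^sub>j\<^sub>+\<^sub>1(t) = \<Sum>j. w\<^sub>j - \<bar>t\<bar> (\<Sum>j. w\<^sub>j / (j + 1))\<close>.  So the
tail contributes to the characteristic function there only through its mass, which is
\<open>decay a i\<close>, and through the following sum.
\<close>

definition mean_inverse_tail :: "real \<Rightarrow> nat \<Rightarrow> real" where
  "mean_inverse_tail a i = (\<Sum>j. tail_weight a i j / (real j + 1))"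

text \<open>
The weights from index \<open>i\<close> on are halved.  The corrections \<open>d\<^sub>0\<close>, \<open>d\<^sub>1\<close> at the indices 0 and 1 restore the two
quantities that determine the characteristic function on \<open>[-1, 1]\<close>: they solve \<open>d\<^sub>0 + d\<^sub>1 = S / 2\<close> and
\<open>d\<^sub>0 + d\<^sub>1 / 2 = T / 2\<close>, where \<open>S\<close> is the mass of the tail and \<open>T\<close> its sum of \<open>w\<^sub>j / (j + 1)\<close>.
\<close>

definition perturbed_weight :: "real \<Rightarrow> nat \<Rightarrow> nat \<Rightarrow> real" where
  "perturbed_weight a i j = decay_weight a j - tail_weight a i j / 2
     + (if j = 0 then mean_inverse_tail a i - decay a i / 2 else 0)
     + (if j = 1 then decay a i - mean_inverse_tail a i else 0)"

text \<open>
A lower bound of the original and the perturbed weights; the correction at index 0 is at least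
\<open>- decay a i / 2\<close>, and the one at index 1 is nonnegative.
\<close>

definition common_weight :: "real \<Rightarrow> nat \<Rightarrow> nat \<Rightarrow> real" where
  "common_weight a i j = decay_weight a j - tail_weight a i j / 2 - (if j = 0 then decay a i / 2 else 0)"

context
  fixes a :: real
  assumes a: "a > 0"
begin

lemma decay_antimono: "i \<le> j \<Longrightarrow> decay a j \<le> decay a i"
  using a by (simp add: decay_def powr_mono2)

lemma decay_weight_pos: "decay_weight a j > 0"
  using a by (simp add: decay_weight_def decay_def powr_less_mono2)

lemma decay_weight_le: "decay_weight a j \<le> decay a j"
  by (simp add: decay_weight_def decay_def)

lemma decay_tendsto_0: "decay a \<longlonglongrightarrow> 0"
  unfolding decay_def using a by real_asymp

lemma tail_weight_sums: "tail_weight a i sums decay a i"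
proof -
  have "(\<lambda>j. decay a (j + i)) \<longlonglongrightarrow> 0"
    using decay_tendsto_0 by (rule LIMSEQ_ignore_initial_segment)
  from telescope_sums'[OF this] have "(\<lambda>j. tail_weight a i (j + i)) sums decay a i"
    by (simp add: tail_weight_def decay_weight_def)
  then show ?thesis
    by (subst (asm) sums_zero_iff_shift) (simp_all add: tail_weight_def)
qed

lemma decay_weight_sums: "decay_weight a sums 1"
  using tail_weight_sums[of 0] by (simp add: tail_weight_def[abs_def] decay_0)

lemma decay_weight_moment: "summable (\<lambda>j. decay_weight a j * (real j + 1))"
proof (rule summable_comparison_test')
  show "summable (\<lambda>j. decay a j * (real j + 1))"
  proof (rule summable_comparison_test_bigo)
    show "summable (\<lambda>j. norm (inverse (real j ^ 2)))"
      using inverse_power_summable[of 2] by simp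
    show "(\<lambda>j. decay a j * (real j + 1)) \<in> O(\<lambda>j. inverse (real j ^ 2))"
      unfolding decay_def using a by real_asymp
  qed
  show "norm (decay_weight a j * (real j + 1)) \<le> decay a j * (real j + 1)" for j
    using decay_weight_le[of j] decay_weight_pos[of j] by (simp add: abs_mult mult_right_mono)
qed

lemma comparable_weights_subset: "w \<in> comparable_weights a \<Longrightarrow> w \<in> weights"
  unfolding weights_def
proof safe
  assume w: "w \<in> comparable_weights a"
  then have w2: "decay_weight a j / 2 \<le> w j" "w j \<le> 2 * decay_weight a j" for j
    by (auto simp: comparable_weights_def)
  show nn: "0 \<le> w j" for j using w2(1)[of j] decay_weight_pos[of j] by linarith
  show "w sums 1" using w by (auto simp: comparable_weights_def)
  show "summable (\<lambda>j. w j * (real j + 1))"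
  proof (rule summable_comparison_test')
    show "summable (\<lambda>j. 2 * (decay_weight a j * (real j + 1)))"
      by (intro summable_mult decay_weight_moment)
    show "norm (w j * (real j + 1)) \<le> 2 * (decay_weight a j * (real j + 1))" for j
      using mult_right_mono[OF w2(2)[of j], of "real j + 1"] nn[of j] by (simp add: abs_mult)
  qed
qed

lemma decay_weight_comparable: "decay_weight a \<in> comparable_weights a"
  using decay_weight_sums decay_weight_pos[THEN less_imp_le] by (auto simp: comparable_weights_def)

text \<open>
A tent of width at most \<open>\<bar>t\<bar>\<close> vanishes at \<open>t\<close>, which leaves only the weights from index \<open>\<lfloor>\<bar>t\<bar>\<rfloor>\<close> on.  The
lower bound drops one more weight: the remaining tents have width at least \<open>\<lfloor>\<bar>t\<bar>\<rfloor> + 2\<close>, hence value at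
least \<open>1 / (\<lfloor>\<bar>t\<bar>\<rfloor> + 2)\<close> at \<open>t\<close>.
\<close>

lemma cos_transform_comparable:
  assumes w: "w \<in> comparable_weights a"
  defines "i \<equiv> \<lambda>t::real. nat \<lfloor>\<bar>t\<bar>\<rfloor>"
  shows "cos_transform (fejer_mixture w) t \<le> 1"
    and "cos_transform (fejer_mixture w) t \<le> 2 * decay a (i t)"
    and "decay a (i t + 1) / (2 * (real (i t) + 2)) \<le> cos_transform (fejer_mixture w) t"
proof -
  note W = comparable_weights_subset[OF w]
  note S = cos_transform_fejer_mixture_sums[OF W, of t]
  have w2: "decay_weight a j / 2 \<le> w j" "w j \<le> 2 * decay_weight a j" "0 \<le> w j" for j
    using w weights_nonneg[OF W, of j] by (auto simp: comparable_weights_def)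
  have it: "real (i t) \<le> \<bar>t\<bar>" "\<bar>t\<bar> < real (i t) + 1" unfolding i_def by linarith+
  show "cos_transform (fejer_mixture w) t \<le> 1"
    using w2(3) tent_le_1 by (intro sums_le[OF _ S weights_sums[OF W]]) (simp add: mult_left_le)
  show "cos_transform (fejer_mixture w) t \<le> 2 * decay a (i t)"
  proof (rule sums_le[OF _ S sums_mult[OF tail_weight_sums]])
    fix j
    show "w j * tent (real j + 1) t \<le> 2 * tail_weight a (i t) j"
    proof (cases "j < i t")
      case True
      then have "real j + 1 \<le> \<bar>t\<bar>" using it by linarith
      then show ?thesis using True by (simp add: tail_weight_def tent_eq_0)
    next
      case False
      have "w j * tent (real j + 1) t \<le> w j" using w2(3)[of j] tent_le_1[of "real j + 1" t] by (simp add: mult_left_le)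
      then show ?thesis using False w2(2)[of j] by (simp add: tail_weight_def)
    qed
  qed
  have "decay a (i t + 1) * (1 / (2 * (real (i t) + 2))) \<le> cos_transform (fejer_mixture w) t"
  proof (rule sums_le[OF _ sums_mult2[OF tail_weight_sums] S])
    fix j
    show "tail_weight a (i t + 1) j * (1 / (2 * (real (i t) + 2))) \<le> w j * tent (real j + 1) t"
    proof (cases "j < i t + 1")
      case False
      then have j: "real (i t) + 1 \<le> real j" by linarith
      have "\<bar>t\<bar> / (real j + 1) \<le> (real (i t) + 1) / (real (i t) + 2)"
      proof -
        have "\<bar>t\<bar> / (real j + 1) \<le> (real (i t) + 1) / (real j + 1)" using it by (intro divide_right_mono) auto
        also have "\<dots> \<le> (real (i t) + 1) / (real (i t) + 2)" using j by (intro divide_left_mono) auto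
        finally show ?thesis .
      qed
      also have "\<dots> = 1 - 1 / (real (i t) + 2)" by (simp add: field_simps)
      finally have tent: "1 / (real (i t) + 2) \<le> tent (real j + 1) t" by (simp add: tent_def)
      have "decay_weight a j / 2 * (1 / (real (i t) + 2)) \<le> w j * tent (real j + 1) t"
        using w2[of j] tent by (intro mult_mono) auto
      then show ?thesis using False by (simp add: tail_weight_def)
    qed (use w2(3) in \<open>simp add: tail_weight_def tent_def\<close>)
  qed
  then show "decay a (i t + 1) / (2 * (real (i t) + 2)) \<le> cos_transform (fejer_mixture w) t" by simp
qed

text \<open>
With \<open>\<beta>\<close> the characteristic function, the logarithm in question is \<open>ln (2 \<pi>) - 2 ln \<beta>(t)\<close> up to sign.  It is
compared with \<open>E(t) = (1 + t\<^sup>2) powr a\<close> through the two bounds on \<open>\<beta>\<close>, where the polynomial loss in the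
lower bound costs a logarithm that \<open>E\<close> absorbs.  For \<open>\<bar>t\<bar> < 1\<close>, where the upper bound on \<open>\<beta>\<close> says
nothing, the constant \<open>ln (2 \<pi>) > 0\<close> takes over.
\<close>

lemma fejer_mixture_supersmooth:
  assumes w: "w \<in> comparable_weights a"
  shows "fejer_mixture w \<in> supersmooth a"
proof -
  note W = comparable_weights_subset[OF w]
  have dens: "fejer_mixture w \<in> even_densities" by (rule fejer_mixture_even_density[OF W])
  define \<beta> where "\<beta> = cos_transform (fejer_mixture w)"
  define E where "E t = (1 + t\<^sup>2) powr a" for t
  define i where "i t = nat \<lfloor>\<bar>t\<bar>\<rfloor>" for t :: real
  have it: "real (i t) \<le> \<bar>t\<bar>" "\<bar>t\<bar> < real (i t) + 1" for t unfolding i_def by linarith+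
  have \<beta>: "\<beta> t \<le> 1" "\<beta> t \<le> 2 * decay a (i t)" "decay a (i t + 1) / (2 * (real (i t) + 2)) \<le> \<beta> t" for t
    using cos_transform_comparable[OF w, of t] by (auto simp: \<beta>_def i_def)
  have pos: "\<beta> t > 0" for t
    using decay_pos[of a "i t + 1"] by (intro less_le_trans[OF _ \<beta>(3)]) auto
  have F: "(cmod (fourier (cfun (fejer_mixture w)) t))\<^sup>2 = (\<beta> t)\<^sup>2 / (2 * pi)" for t
    by (simp add: fourier_even_density[OF dens] \<beta>_def norm_divide power_divide del: of_real_divide)
  define L where "L t = \<bar>ln ((cmod (fourier (cfun (fejer_mixture w)) t))\<^sup>2)\<bar>" for t
  \<comment> \<open>Just enough to absorb the factor 2 in the upper bound of the characteristic function.\<close>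
  have ln2pi: "ln (2 * pi) \<ge> 2 * ln 2"
  proof -
    have "2 * ln 2 = ln (4 :: real)" using ln_mult[of 2 "2::real"] by simp
    also have "\<dots> \<le> ln (2 * pi)" using pi_ge_two by (intro ln_mono) auto
    finally show ?thesis .
  qed
  have ln2: "ln 2 > (0::real)" by simp
  have L: "L t = ln (2 * pi) - 2 * ln (\<beta> t)" for t
  proof -
    have "ln ((\<beta> t)\<^sup>2 / (2 * pi)) = 2 * ln (\<beta> t) - ln (2 * pi)"
      using pos[of t] by (simp add: ln_div ln_realpow)
    moreover have "ln (\<beta> t) \<le> 0" using pos \<beta>(1) by simp
    ultimately show ?thesis using ln2pi ln2 unfolding L_def F by linarith
  qed
  \<comment> \<open>With \<open>x = \<lfloor>\<bar>t\<bar>\<rfloor> + 1\<close>, the last term of \<open>c2\<close> bounds \<open>x powr (2 a) + ln x\<close> by a multiple of \<open>E\<close>.  The two terms of \<open>c1\<close> treat \<open>\<bar>t\<bar> < 1\<close> and \<open>\<bar>t\<bar> \<ge> 1\<close>.\<close>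
  define c2 where "c2 = ln (2 * pi) + 4 * ln 2 + 2 * (2 powr (2 * a) * (1 + 1 / (2 * a)))"
  define c1 where "c1 = min (ln (2 * pi) / 2 powr a) (2 / 8 powr a)"
  have "ln (2 * pi) > 0" using ln2pi ln2 by linarith
  moreover have "0 < 2 powr (2 * a) * (1 + 1 / (2 * a))" using a by (intro mult_pos_pos add_pos_pos) auto
  ultimately have c: "c1 > 0" "c2 > 0" using ln2 unfolding c1_def c2_def
    by (simp_all only: min_less_iff_conj) (auto simp: add_pos_pos)
  have E1: "1 \<le> E t" for t
    unfolding E_def using a by (intro ge_one_powr_ge_zero) auto
  have upper: "L t \<le> c2 * E t" for t
  proof -
    define x where "x = real (i t) + 1"
    have x1: "1 \<le> x" by (simp add: x_def)
    have "x \<le> 1 + \<bar>t\<bar>" using it(1)[of t] by (simp add: x_def)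
    also have "\<dots> \<le> sqrt (1 + t\<^sup>2) + sqrt (1 + t\<^sup>2)"
      by (intro add_mono real_le_rsqrt) auto
    also have "\<dots> = 2 * sqrt (1 + t\<^sup>2)" by simp
    finally have "x powr (2 * a) \<le> (2 * sqrt (1 + t\<^sup>2)) powr (2 * a)"
      using a x1 by (intro powr_mono2) auto
    also have "\<dots> = 2 powr (2 * a) * E t"
      unfolding E_def by (simp add: powr_mult powr_half_sqrt[symmetric] powr_powr add_nonneg_nonneg)
    finally have xE: "x powr (2 * a) \<le> 2 powr (2 * a) * E t" .
    have "ln (decay a (i t + 1) / (2 * (real (i t) + 2))) \<le> ln (\<beta> t)"
      using decay_pos[of a "i t + 1"] \<beta>(3)[of t] by (intro ln_mono) auto
    moreover have "ln (d / (2 * r)) = ln d - ln 2 - ln r" if "0 < d" "0 < r" for d r :: real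
      using that by (simp add: ln_div ln_mult)
    from this[OF decay_pos, of "real (i t) + 2" a "i t + 1"]
    have "ln (decay a (i t + 1) / (2 * (real (i t) + 2))) = - (x powr (2 * a)) - ln 2 - ln (real (i t) + 2)"
      by (simp add: decay_def x_def add.commute)
    moreover have "ln (real (i t) + 2) \<le> ln (2 * x)" by (intro ln_mono) (auto simp: x_def)
    moreover have "ln (2 * x) = ln 2 + ln x" using x1 by (simp add: ln_mult)
    moreover have "ln x \<le> x powr (2 * a) / (2 * a)" using a x1 by (intro ln_powr_bound) auto
    ultimately have "L t \<le> ln (2 * pi) + 4 * ln 2 + 2 * (x powr (2 * a) * (1 + 1 / (2 * a)))"
      unfolding L by (simp add: distrib_left)
    also have "\<dots> \<le> (ln (2 * pi) + 4 * ln 2) * E t + 2 * (2 powr (2 * a) * E t * (1 + 1 / (2 * a)))"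
    proof (intro add_mono mult_left_mono mult_right_mono xE)
      show "ln (2 * pi) + 4 * ln 2 \<le> (ln (2 * pi) + 4 * ln 2) * E t"
      proof -
        have "0 \<le> ln (2 * pi) + 4 * ln 2" using ln2pi ln2 by linarith
        from mult_left_mono[OF E1[of t] this] show ?thesis by (simp only: mult_1_right)
      qed
    qed (use a in auto)
    also have "\<dots> = c2 * E t" by (simp add: c2_def algebra_simps)
    finally show ?thesis .
  qed
  have lower: "c1 * E t \<le> L t" for t
  proof (cases "\<bar>t\<bar> < 1")
    case True
    then have "E t \<le> 2 powr a"
      unfolding E_def using a by (intro powr_mono2) (auto simp: abs_square_less_1 less_imp_le)
    moreover have "0 \<le> ln (2 * pi) / 2 powr a"
      by (intro divide_nonneg_nonneg) (use ln2pi ln2 in linarith, simp)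
    ultimately have "c1 * E t \<le> ln (2 * pi) / 2 powr a * 2 powr a"
      using E1[of t] by (intro mult_mono) (auto simp: c1_def)
    also have "\<dots> \<le> L t" unfolding L using pos[of t] \<beta>(1)[of t] by simp
    finally show ?thesis .
  next
    case False
    have "i t \<ge> 1" using False unfolding i_def by linarith
    then have "\<bar>t\<bar> / 2 \<le> real (i t)" using it(2)[of t] by linarith
    moreover have "sqrt ((1 + t\<^sup>2) / 8) \<le> \<bar>t\<bar> / 2"
    proof (rule real_le_lsqrt)
      have "1 \<le> t\<^sup>2" using False by (simp add: abs_square_less_1 not_less[symmetric])
      then show "(1 + t\<^sup>2) / 8 \<le> (\<bar>t\<bar> / 2)\<^sup>2" by (simp add: power_divide)
    qed auto
    ultimately have "sqrt ((1 + t\<^sup>2) / 8) powr (2 * a) \<le> real (i t) powr (2 * a)"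
      using a by (intro powr_mono2) auto
    also have "sqrt ((1 + t\<^sup>2) / 8) powr (2 * a) = E t / 8 powr a"
      unfolding E_def by (simp add: powr_divide powr_half_sqrt[symmetric] powr_powr add_nonneg_nonneg)
    finally have iE: "E t / 8 powr a \<le> real (i t) powr (2 * a)" .
    have "ln (\<beta> t) \<le> ln (2 * decay a (i t))"
      using pos \<beta>(2) by (intro ln_mono) auto
    also have "\<dots> = ln 2 - real (i t) powr (2 * a)"
      using decay_pos[of a "i t"] by (simp add: ln_mult decay_def)
    finally have "2 * (E t / 8 powr a) \<le> L t" unfolding L using iE ln2pi by linarith
    moreover have "c1 * E t \<le> 2 / 8 powr a * E t"
      using E1[of t] by (intro mult_right_mono) (auto simp: c1_def)
    ultimately show ?thesis by simp
  qed
  have "\<exists>d>0. \<forall>t. d \<le> E t * inverse (L t) \<and> E t * inverse (L t) \<le> inverse d"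
  proof (intro exI[of _ "min c1 (1 / c2)"] conjI allI)
    show "0 < min c1 (1 / c2)" using c by simp
    fix t
    have Lp: "L t > 0" using lower[of t] c E1[of t] by (smt (verit) mult_pos_pos)
    have "1 / c2 \<le> E t * inverse (L t)"
      using upper[of t] c Lp by (simp add: field_simps)
    then show "min c1 (1 / c2) \<le> E t * inverse (L t)" by simp
    have "E t * inverse (L t) \<le> 1 / c1" using lower[of t] c Lp by (simp add: field_simps)
    also have "\<dots> \<le> inverse (min c1 (1 / c2))"
      using c by (simp add: inverse_eq_divide divide_left_mono)
    finally show "E t * inverse (L t) \<le> inverse (min c1 (1 / c2))" .
  qed
  moreover have "fejer_mixture w \<in> error_densities"
  proof -
    have "0 < (cmod (fourier (cfun (fejer_mixture w)) t))\<^sup>2" for t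
      unfolding F using pos[of t] by simp
    then show ?thesis
      using dens unfolding error_densities_def even_densities_def by blast
  qed
  ultimately show ?thesis
    unfolding supersmooth_def E_def L_def by blast
qed

lemma mean_inverse_tail_sums: "(\<lambda>j. tail_weight a i j / (real j + 1)) sums mean_inverse_tail a i"
  and mean_inverse_tail_bounds: "0 \<le> mean_inverse_tail a i" "mean_inverse_tail a i \<le> decay a i"
proof -
  have le: "0 \<le> tail_weight a i j / (real j + 1)" "tail_weight a i j / (real j + 1) \<le> tail_weight a i j" for j
    using decay_weight_pos[of j] by (auto simp: tail_weight_def field_simps)
  have s: "summable (\<lambda>j. tail_weight a i j / (real j + 1))"
  proof (rule summable_comparison_test'[of "tail_weight a i"])
    show "summable (tail_weight a i)" using tail_weight_sums by (auto simp: sums_iff)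
    show "norm (tail_weight a i j / (real j + 1)) \<le> tail_weight a i j" for j
      using le[of j] by (simp only: real_norm_def abs_of_nonneg)
  qed
  then show "(\<lambda>j. tail_weight a i j / (real j + 1)) sums mean_inverse_tail a i"
    unfolding mean_inverse_tail_def by (rule summable_sums)
  note sums = this
  show "0 \<le> mean_inverse_tail a i" by (rule sums_le[OF _ sums_zero sums]) (rule le)
  show "mean_inverse_tail a i \<le> decay a i" by (rule sums_le[OF _ sums tail_weight_sums]) (rule le)
qed

lemma perturbed_weight_comparable:
  assumes i: "2 \<le> i" and small: "decay a i \<le> decay_weight a 0" "decay a i \<le> decay_weight a 1"
  shows "perturbed_weight a i \<in> comparable_weights a"
  unfolding comparable_weights_def
proof safe
  have "perturbed_weight a i sums (1 - decay a i / 2 + (mean_inverse_tail a i - decay a i / 2) + (decay a i - mean_inverse_tail a i))"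
    unfolding perturbed_weight_def
    by (intro sums_add sums_diff decay_weight_sums sums_divide tail_weight_sums
        sums_single[of 0 "\<lambda>_. mean_inverse_tail a i - decay a i / 2"] sums_single[of 1 "\<lambda>_. decay a i - mean_inverse_tail a i"])
  then show "perturbed_weight a i sums 1" by simp
  fix j
  show "decay_weight a j / 2 \<le> perturbed_weight a i j" "perturbed_weight a i j \<le> 2 * decay_weight a j"
    using mean_inverse_tail_bounds[of i] small i decay_weight_pos[of j]
    by (auto simp: perturbed_weight_def tail_weight_def)
qed

text \<open>
The mass and the sum of \<open>w\<^sub>j / (j + 1)\<close> are unchanged, and they determine the values on \<open>[-1, 1]\<close>.
\<close>

lemma cos_transform_perturbed_low:
  assumes "perturbed_weight a i \<in> weights" and t: "\<bar>t\<bar> \<le> 1"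
  shows "cos_transform (fejer_mixture (perturbed_weight a i)) t = cos_transform (fejer_mixture (decay_weight a)) t"
proof (rule sums_unique2)
  show "(\<lambda>j. perturbed_weight a i j * tent (real j + 1) t) sums cos_transform (fejer_mixture (perturbed_weight a i)) t"
    by (rule cos_transform_fejer_mixture_sums) fact
  have tent: "tent (real j + 1) t = 1 - \<bar>t\<bar> / (real j + 1)" for j
    using t by (simp add: tent_def max_def field_simps)
  let ?T = "mean_inverse_tail a i" and ?S = "decay a i"
  have "(\<lambda>j. decay_weight a j * tent (real j + 1) t - (tail_weight a i j - \<bar>t\<bar> * (tail_weight a i j / (real j + 1))) / 2
      + (if j = 0 then (?T - ?S / 2) * tent (real j + 1) t else 0) + (if j = 1 then (?S - ?T) * tent (real j + 1) t else 0)) sums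
     (cos_transform (fejer_mixture (decay_weight a)) t - (?S - \<bar>t\<bar> * ?T) / 2
      + (?T - ?S / 2) * tent (real 0 + 1) t + (?S - ?T) * tent (real 1 + 1) t)"
    by (intro sums_add sums_diff sums_divide sums_mult tail_weight_sums mean_inverse_tail_sums
        cos_transform_fejer_mixture_sums comparable_weights_subset decay_weight_comparable
        sums_single[of 0 "\<lambda>j. (?T - ?S / 2) * tent (real j + 1) t"] sums_single[of 1 "\<lambda>j. (?S - ?T) * tent (real j + 1) t"])
  moreover have "(?S - \<bar>t\<bar> * ?T) / 2 = (?T - ?S / 2) * tent (real 0 + 1) t + (?S - ?T) * tent (real 1 + 1) t"
    unfolding tent by (simp add: field_simps)
  moreover have "decay_weight a j * tent (real j + 1) t - (tail_weight a i j - \<bar>t\<bar> * (tail_weight a i j / (real j + 1))) / 2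
      + (if j = 0 then (?T - ?S / 2) * tent (real j + 1) t else 0) + (if j = 1 then (?S - ?T) * tent (real j + 1) t else 0)
      = perturbed_weight a i j * tent (real j + 1) t" for j
  proof -
    have "w * y - (\<tau> - \<bar>t\<bar> * (\<tau> * x)) / 2 + (if j = 0 then A * y else 0) + (if j = 1 then B * y else 0) =
        (w - \<tau> / 2 + (if j = 0 then A else 0) + (if j = 1 then B else 0)) * y"
      if "y = 1 - \<bar>t\<bar> * x" for w y \<tau> x A B :: real
      unfolding that by (simp add: field_simps)
    from this[of "tent (real j + 1) t" "1 / (real j + 1)"] show ?thesis
      by (simp add: perturbed_weight_def tent)
  qed
  ultimately show "(\<lambda>j. perturbed_weight a i j * tent (real j + 1) t) sums cos_transform (fejer_mixture (decay_weight a)) t"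
    by simp
qed

text \<open>
Only the halved weights contribute at frequencies beyond \<open>i\<close>.
\<close>

lemma cos_transform_perturbed_high:
  assumes "perturbed_weight a i \<in> weights" and i: "2 \<le> i" and t: "real i \<le> \<bar>t\<bar>"
  shows "cos_transform (fejer_mixture (perturbed_weight a i)) t = cos_transform (fejer_mixture (decay_weight a)) t / 2"
proof (rule sums_unique2)
  show "(\<lambda>j. perturbed_weight a i j * tent (real j + 1) t) sums cos_transform (fejer_mixture (perturbed_weight a i)) t"
    by (rule cos_transform_fejer_mixture_sums) fact
  have eq: "perturbed_weight a i j * tent (real j + 1) t = decay_weight a j * tent (real j + 1) t / 2" for j
  proof (cases "j < i")
    case True
    then have "real j + 1 \<le> \<bar>t\<bar>" using t by linarith
    then show ?thesis by (simp add: tent_eq_0)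
  qed (use i in \<open>simp add: perturbed_weight_def tail_weight_def\<close>)
  show "(\<lambda>j. perturbed_weight a i j * tent (real j + 1) t) sums (cos_transform (fejer_mixture (decay_weight a)) t / 2)"
    unfolding eq by (intro sums_divide cos_transform_fejer_mixture_sums comparable_weights_subset decay_weight_comparable)
qed

lemma common_weight_sums: "common_weight a i sums (1 - decay a i)"
proof -
  have "common_weight a i sums (1 - decay a i / 2 - decay a i / 2)"
    unfolding common_weight_def
    by (intro sums_diff decay_weight_sums sums_divide tail_weight_sums sums_single[of 0 "\<lambda>_. decay a i / 2"])
  then show ?thesis by simp
qed

lemma common_weight_bounds:
  assumes "2 \<le> i" "decay a i \<le> decay_weight a 0"
  shows "0 \<le> common_weight a i j" "common_weight a i j \<le> decay_weight a j" "common_weight a i j \<le> perturbed_weight a i j"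
  using assms mean_inverse_tail_bounds[of i] decay_weight_pos[of j] decay_pos[of a i]
  by (auto simp: common_weight_def perturbed_weight_def tail_weight_def)

end

lemma scaled_weights:
  assumes "\<And>j. 0 \<le> u j" "u sums c" "c > 0" "\<And>j. u j \<le> w j" "w \<in> weights"
  shows "(\<lambda>j. u j / c) \<in> weights"
  unfolding weights_def
proof safe
  show "0 \<le> u j / c" for j using assms by simp
  show "(\<lambda>j. u j / c) sums 1" using sums_divide[OF assms(2), of c] assms(3) by simp
  show "summable (\<lambda>j. u j / c * (real j + 1))"
  proof (rule summable_comparison_test')
    show "summable (\<lambda>j. w j * (real j + 1) / c)"
      by (intro summable_divide weights_moment assms)
    show "norm (u j / c * (real j + 1)) \<le> w j * (real j + 1) / c" for j
      using assms(1,4)[of j] assms(3) by (simp add: abs_mult divide_right_mono mult_right_mono)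
  qed
qed

lemma dominates_fejer_mixture:
  assumes "u \<in> weights" "w \<in> weights" "c \<ge> 0" "\<And>j. c * u j \<le> w j"
  shows "dominates c (law (fejer_mixture w)) (law (fejer_mixture u))"
proof (rule dominates_law)
  fix x
  have "c * fejer_mixture u x = (\<Sum>j. c * (u j * fejer (real j + 1) x))"
    unfolding fejer_mixture_def by (rule suminf_mult[symmetric]) (rule summable_fejer_mixture[OF assms(1)])
  also have "\<dots> \<le> fejer_mixture w x"
    unfolding fejer_mixture_def
  proof (rule suminf_le)
    show "c * (u j * fejer (real j + 1) x) \<le> w j * fejer (real j + 1) x" for j
      using mult_right_mono[OF assms(4)[of j] fejer_nonneg[of "real j + 1" x]] by (simp add: mult.assoc)
  qed (intro summable_mult summable_fejer_mixture assms)+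
  finally show "c * fejer_mixture u x \<le> fejer_mixture w x" .
qed (use even_densitiesD(1)[OF fejer_mixture_even_density] assms in auto)

section \<open>Two hypotheses that the samples cannot separate\<close>

text \<open>
The bound on \<open>g\<close> keeps the weighted transform of a signal bounded near \<open>\<plusminus> k\<close>, where \<open>\<bar>t\<bar> \<le> i + 3/2\<close>; the
bound on \<open>l\<close> then makes its Sobolev norm small enough for the ball.  The last two assumptions leave room for the
corrections of the noise weights.
\<close>

locale hypothesis_pair =
  fixes p s \<rho> a l g :: real and i :: nat
  assumes p: "p > 0" and s: "0 \<le> s" and a: "a > 0"
    and l: "0 < l" "l \<le> 1 / 4" "2 * l * (2 powr p + 1) \<le> \<rho>"
    and g: "0 \<le> g" "(2 * g)\<^sup>2 * (1 + (real i + 3 / 2)\<^sup>2) powr p \<le> 1"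
    and i: "2 \<le> i" and small: "decay a i \<le> decay_weight a 0" "decay a i \<le> decay_weight a 1"
begin

text \<open>
The middle of \<open>[i, i + 1]\<close>: the tents of half-width \<open>l \<le> 1/4\<close> around \<open>\<plusminus> k\<close> then lie in \<open>i \<le> \<bar>t\<bar>\<close>.
\<close>

definition k :: real where "k = real i + 1 / 2"

abbreviation signal :: "real \<Rightarrow> real \<Rightarrow> real" where
  "signal h \<equiv> modulated_fejer l k h"

lemma k_ge: "2 \<le> k" using i by (simp add: k_def)

lemma g_le: "2 * g \<le> 1"
proof -
  have "1 \<le> (1 + (real i + 3 / 2)\<^sup>2) powr p"
    using p by (intro ge_one_powr_ge_zero) auto
  then have "(2 * g)\<^sup>2 * 1 \<le> (2 * g)\<^sup>2 * (1 + (real i + 3 / 2)\<^sup>2) powr p"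
    by (intro mult_left_mono) auto
  then have "(2 * g)\<^sup>2 \<le> 1\<^sup>2" using g(2) by simp
  then show ?thesis by (rule power2_le_imp_le) simp
qed

lemma signal_even_density: "0 \<le> h \<Longrightarrow> h \<le> 2 * g \<Longrightarrow> signal h \<in> even_densities"
  using l k_ge g_le by (intro modulated_fejer_even_density) auto

lemma fourier_signal:
  assumes "0 \<le> h" "h \<le> 2 * g"
  shows "fourier (cfun (signal h)) t =
    complex_of_real ((tent l t + h / 2 * (tent l (t - k) + tent l (t + k))) / sqrt (2 * pi))"
  using fourier_even_density[OF signal_even_density[OF assms]] cos_transform_modulated_fejer[OF l(1)] by simp

text \<open>
The transform of a signal lives on three disjoint intervals of length \<open>2 l\<close>, and on each of them the
weighted square is bounded by a constant.
\<close>

lemma sobolev_weight_bound: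
  assumes h: "0 \<le> h" "h \<le> 2 * g"
  shows "(1 + t\<^sup>2) powr p * (cmod (fourier (cfun (signal h)) t))\<^sup>2
    \<le> (2 powr p + 1) / (2 * pi) * (indicator {- l..l} t + indicator {k - l..k + l} t + indicator {- k - l..- k + l} t)"
proof -
  define \<alpha> where "\<alpha> = tent l t + h / 2 * (tent l (t - k) + tent l (t + k))"
  define I :: real where "I = indicator {- l..l} t + indicator {k - l..k + l} t + indicator {- k - l..- k + l} t"
  have I: "0 \<le> I" "t \<in> {- l..l} \<union> {k - l..k + l} \<union> {- k - l..- k + l} \<Longrightarrow> 1 \<le> I"
    by (auto simp: I_def indicator_def)
  have F: "(cmod (fourier (cfun (signal h)) t))\<^sup>2 = \<alpha>\<^sup>2 / (2 * pi)"
    by (simp add: fourier_signal[OF h] \<alpha>_def norm_divide power_divide del: of_real_divide of_real_add of_real_mult)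
  have tri1: "tent l x \<le> 1" for x using tent_le_1[OF l(1)] .
  have "(1 + t\<^sup>2) powr p * \<alpha>\<^sup>2 \<le> (2 powr p + 1) * I"
  proof (cases "t \<in> {- l..l}")
    case True
    then have "\<alpha> = tent l t" using l k_ge by (simp add: \<alpha>_def tent_eq_0)
    then have "\<alpha>\<^sup>2 \<le> 1" using tri1[of t] by (simp add: power_le_one)
    have "\<bar>t\<bar> \<le> 1" using True l by auto
    then have "(1 + t\<^sup>2) powr p \<le> 2 powr p"
      using p by (intro powr_mono2) (auto simp: abs_square_le_1)
    then have "(1 + t\<^sup>2) powr p * \<alpha>\<^sup>2 \<le> 2 powr p * 1"
      using \<open>\<alpha>\<^sup>2 \<le> 1\<close> by (intro mult_mono) auto
    also have "\<dots> \<le> (2 powr p + 1) * I"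
      using I True by (intro mult_mono) auto
    finally show ?thesis .
  next
    case nl: False
    then have t0: "tent l t = 0" using l by (intro tent_eq_0) auto
    show ?thesis
    proof (cases "\<bar>t - k\<bar> \<le> l \<or> \<bar>t + k\<bar> \<le> l")
      case True
      then have tI: "t \<in> {- l..l} \<union> {k - l..k + l} \<union> {- k - l..- k + l}" by auto
      have "tent l (t - k) + tent l (t + k) \<le> 1"
        using True l k_ge tri1[of "t - k"] tri1[of "t + k"] tent_eq_0[of l "t - k"] tent_eq_0[of l "t + k"] by fastforce
      then have "h / 2 * (tent l (t - k) + tent l (t + k)) \<le> 2 * g * 1"
        using h g by (intro mult_mono) auto
      then have "\<alpha>\<^sup>2 \<le> (2 * g)\<^sup>2"
        using h by (intro power_mono) (auto simp: \<alpha>_def t0)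
      moreover have "(1 + t\<^sup>2) powr p \<le> (1 + (real i + 3 / 2)\<^sup>2) powr p"
      proof (intro powr_mono2)
        have "\<bar>t\<bar> \<le> \<bar>real i + 3 / 2\<bar>" using True l by (auto simp: k_def)
        then show "1 + t\<^sup>2 \<le> 1 + (real i + 3 / 2)\<^sup>2" by (simp only: abs_le_square_iff add_left_mono)
      qed (use p in auto)
      ultimately have "(1 + t\<^sup>2) powr p * \<alpha>\<^sup>2 \<le> (1 + (real i + 3 / 2)\<^sup>2) powr p * (2 * g)\<^sup>2"
        by (intro mult_mono) auto
      also have "\<dots> \<le> 1 * 1" using g(2) by (simp add: mult.commute)
      also have "\<dots> \<le> (2 powr p + 1) * I"
        using I(2)[OF tI] by (intro mult_mono) auto
      finally show ?thesis .
    next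
      case False
      then have "\<alpha> = 0" using l by (simp add: \<alpha>_def t0 tent_eq_0)
      then show ?thesis using I(1) by simp
    qed
  qed
  then have "(1 + t\<^sup>2) powr p * \<alpha>\<^sup>2 / (2 * pi) \<le> (2 powr p + 1) * I / (2 * pi)"
    by (rule divide_right_mono) simp
  then show ?thesis unfolding F I_def by simp
qed

lemma signal_sobolev_ball:
  assumes h: "0 \<le> h" "h \<le> 2 * g"
  shows "cfun (signal h) \<in> sobolev_ball p \<rho>"
proof -
  let ?H = "(2 powr p + 1) / (2 * pi)"
  have "sobolev_norm2 p (cfun (signal h)) \<le>
     (\<integral>\<^sup>+t. ennreal ?H * (indicator {- l..l} t + indicator {k - l..k + l} t + indicator {- k - l..- k + l} t) \<partial>lborel)"
    unfolding sobolev_norm2_def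
  proof (rule nn_integral_mono)
    fix t
    have "ennreal (?H * (indicator {- l..l} t + indicator {k - l..k + l} t + indicator {- k - l..- k + l} t))
      = ennreal ?H * (indicator {- l..l} t + indicator {k - l..k + l} t + indicator {- k - l..- k + l} t)"
      by (subst ennreal_mult') (simp_all add: ennreal_plus ennreal_indicator)
    then show "ennreal ((1 + t\<^sup>2) powr p * (cmod (fourier (cfun (signal h)) t))\<^sup>2) \<le>
        ennreal ?H * (indicator {- l..l} t + indicator {k - l..k + l} t + indicator {- k - l..- k + l} t)"
      using ennreal_leI[OF sobolev_weight_bound[OF h, of t]] by simp
  qed
  also have "\<dots> = ennreal (?H * (6 * l))"
    using l by (simp add: nn_integral_cmult nn_integral_add ennreal_plus[symmetric] ennreal_mult[symmetric] del: ennreal_plus)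
  also have "\<dots> \<le> ennreal \<rho>"
  proof (rule ennreal_leI)
    have "6 * l / (2 * pi) \<le> 2 * l" using l pi_ge_two by (simp add: divide_le_eq)
    then have "(2 powr p + 1) * (6 * l / (2 * pi)) \<le> (2 powr p + 1) * (2 * l)"
      by (intro mult_left_mono) auto
    also have "\<dots> \<le> \<rho>" using l(3) by (simp only: mult_ac)
    finally show "?H * (6 * l) \<le> \<rho>" by (simp only: times_divide_eq_left times_divide_eq_right)
  qed
  finally have "sobolev_norm2 p (cfun (signal h)) \<le> ennreal \<rho>" .
  then show ?thesis
    using even_densitiesD(6)[OF signal_even_density[OF h]]
    by (auto simp: sobolev_ball_def sobolev_def intro: le_less_trans)
qed

text \<open>
The transforms of the two signals differ by \<open>g / 2\<close> times a tent around \<open>k\<close> (and one around \<open>- k\<close>), divided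
by \<open>sqrt (2 \<pi>)\<close>; on the band this tent is at least \<open>1/2\<close>.
\<close>

lemma band_separation:
  "g * l / (8 * sqrt (2 * pi)) \<le>
     cmod (band k (k + l / 2) (fourier (cfun (signal (2 * g)))) - band k (k + l / 2) (fourier (cfun (signal g))))"
proof -
  let ?I = "{k..k + l / 2}"
  let ?F = "\<lambda>h. fourier (cfun (signal h))"
  have L2: "?F h \<in> L2" if "0 \<le> h" "h \<le> 2 * g" for h
    by (intro fourier_L2_limit even_densitiesD(6) signal_even_density that)
  have int: "integrable lborel (\<lambda>t. indicator ?I t * (?F (2 * g) t - ?F g t))"
    using g by (intro integrable_band L2_diff L2) auto
  let ?c = "g / (4 * sqrt (2 * pi))"
  have "(LINT t|lborel. ?c * indicator ?I t) \<le> (LINT t|lborel. Re (indicator ?I t * (?F (2 * g) t - ?F g t)))"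
  proof (rule integral_mono)
    show "integrable lborel (\<lambda>t. Re (indicator ?I t * (?F (2 * g) t - ?F g t)))"
      by (rule integrable_bounded_linear[OF bounded_linear_Re int])
    show "?c * indicator ?I t \<le> Re (indicator ?I t * (?F (2 * g) t - ?F g t))" for t
    proof (cases "t \<in> ?I")
      case True
      then have "1 / 2 \<le> tent l (t - k)" using l by (simp add: tent_def max_def field_simps)
      then have "1 / 2 \<le> tent l (t - k) + tent l (t + k)" using tent_nonneg[of l "t + k"] by linarith
      then have "g / 2 * (1 / 2) / sqrt (2 * pi) \<le> g / 2 * (tent l (t - k) + tent l (t + k)) / sqrt (2 * pi)"
        using g by (intro divide_right_mono mult_left_mono) auto
      also have "\<dots> = Re (?F (2 * g) t - ?F g t)"
        using g by (simp add: fourier_signal diff_divide_distrib[symmetric] del: of_real_divide of_real_add of_real_mult)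
      finally show ?thesis using True by simp
    qed simp
    show "integrable lborel (\<lambda>t. ?c * indicator ?I t)"
      by (intro integrable_mult_right integrable_real_indicator) (use l in auto)
  qed
  moreover have "(LINT t|lborel. ?c * indicator ?I t) = g * l / (8 * sqrt (2 * pi))"
    using l by simp
  moreover have "(LINT t|lborel. Re (indicator ?I t * (?F (2 * g) t - ?F g t))) = Re (band k (k + l / 2) (\<lambda>t. ?F (2 * g) t - ?F g t))"
    unfolding band_def by (rule integral_bounded_linear[OF bounded_linear_Re int])
  moreover have "band k (k + l / 2) (\<lambda>t. ?F (2 * g) t - ?F g t) = band k (k + l / 2) (?F (2 * g)) - band k (k + l / 2) (?F g)"
    using g by (intro band_diff L2) auto
  ultimately show ?thesis
    using complex_Re_le_cmod[of "band k (k + l / 2) (?F (2 * g)) - band k (k + l / 2) (?F g)"] by simp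
qed

text \<open>
The supremum is at least the mean of the risks at the two pairs.
\<close>

lemma maximal_risk_ge:
  assumes T: "T \<in> estimators n m"
    and e: "e0 \<in> supersmooth a" "e1 \<in> supersmooth a" "e0 \<in> even_densities" "e1 \<in> even_densities"
    and P: "real_distribution P" and Q: "real_distribution Q"
    and Y: "dominates cY (law (signal g) \<star> law e0) P" "dominates cY (law (signal (2 * g)) \<star> law e1) P" "0 \<le> cY"
    and E: "dominates cE (law e0) Q" "dominates cE (law e1) Q" "0 \<le> cE"
    and c: "1 / 2 \<le> cY ^ n * cE ^ m"
  shows "ennreal (l / (512 * pi) * (g\<^sup>2 * (1 + k\<^sup>2) powr s)) \<le>
    (SUP (fX, f\<epsilon>) \<in> {f \<in> L2_densities. cfun f \<in> sobolev_ball p \<rho>} \<times> supersmooth a. risk s n m T fX f\<epsilon>)"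
    (is "ennreal ?D \<le> ?sup")
proof -
  have dens: "signal g \<in> even_densities" "signal (2 * g) \<in> even_densities"
    using g by (auto intro: signal_even_density)
  have mem: "signal g \<in> {f \<in> L2_densities. cfun f \<in> sobolev_ball p \<rho>}"
     "signal (2 * g) \<in> {f \<in> L2_densities. cfun f \<in> sobolev_ball p \<rho>}"
    using dens signal_sobolev_ball[of g] signal_sobolev_ball[of "2 * g"] g by (auto simp: even_densities_def)
  let ?B = "\<lambda>h. band k (k + l / 2) (fourier (cfun (signal h)))"
  have D0: "0 \<le> ?D" using l by simp
  \<comment> \<open>The band has length \<open>l / 2\<close>; the factor 2 accounts for the mean of the two risks.\<close>
  have "2 * ?D = (1 + k\<^sup>2) powr s / (4 * (k + l / 2 - k)) * (g * l / (8 * sqrt (2 * pi)))\<^sup>2"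
    using l by (simp add: power_mult_distrib power_divide power2_eq_square field_simps)
  also have "\<dots> \<le> (1 + k\<^sup>2) powr s / (4 * (k + l / 2 - k)) * (cmod (?B (2 * g) - ?B g))\<^sup>2"
    using l g by (intro mult_left_mono power_mono band_separation) auto
  finally have "ennreal (2 * ?D) \<le> ennreal ((1 + k\<^sup>2) powr s / (4 * (k + l / 2 - k)) * (cmod (?B (2 * g) - ?B g))\<^sup>2)"
    by (rule ennreal_leI)
  also have "\<dots> \<le> risk s n m T (signal g) e0 + risk s n m T (signal (2 * g)) e1"
    using k_ge l by (intro two_point_risk[OF T dens e(3,4) P Q Y E c _ _ s]) auto
  also have "\<dots> \<le> ?sup + ?sup"
    using mem e by (intro add_mono SUP_upper2[of "(signal g, e0)"] SUP_upper2[of "(signal (2 * g), e1)"]) auto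
  finally have "ennreal ?D + ennreal ?D \<le> ?sup + ?sup"
    using D0 by (simp add: ennreal_plus[symmetric] del: ennreal_plus)
  then show ?thesis
    by (meson add_strict_mono leI leD)
qed

abbreviation noise :: "real \<Rightarrow> real" where "noise \<equiv> fejer_mixture (decay_weight a)"

lemma decay_weight_weights: "decay_weight a \<in> weights"
  by (intro comparable_weights_subset[OF a] decay_weight_comparable[OF a])

lemma decay_lt_1: "decay a i < 1"
  using decay_weight_pos[OF a, of i] decay_pos[of a "Suc i"] decay_antimono[OF a, of 1 i] decay_weight_pos[OF a, of 0] i
  by (simp add: decay_weight_def decay_0)

lemma one_minus_decay_power:
  assumes "decay a i \<le> 1 / (2 * real n)" "n \<ge> 1"
  shows "1 / 2 \<le> (1 - decay a i) ^ n"
proof -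
  have "real n * decay a i \<le> real n * (1 / (2 * real n))" using assms by (intro mult_left_mono) auto
  also have "\<dots> = 1 / 2" using assms by simp
  finally have "1 / 2 \<le> 1 + real n * (- decay a i)" by simp
  also have "\<dots> \<le> (1 + - decay a i) ^ n"
    using decay_lt_1 by (intro Bernoulli_inequality) simp
  finally show ?thesis by simp
qed

text \<open>
The component \<open>u\<close> shared by the laws of \<open>Y\<close> consists of the noise kernels of width at most \<open>i\<close>.  Their
characteristic functions vanish for \<open>\<bar>t\<bar> \<ge> i\<close>, where the signals differ.
\<close>

lemma maximal_risk_ge_Y_sample:
  assumes T: "T \<in> estimators n m" and n: "decay a i \<le> 1 / (2 * real n)" "n \<ge> 1"
  shows "ennreal (l / (512 * pi) * (g\<^sup>2 * (1 + k\<^sup>2) powr s)) \<le>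
    (SUP (fX, f\<epsilon>) \<in> {f \<in> L2_densities. cfun f \<in> sobolev_ball p \<rho>} \<times> supersmooth a. risk s n m T fX f\<epsilon>)"
proof -
  define c where "c = 1 - decay a i"
  have c: "c > 0" using decay_lt_1 by (simp add: c_def)
  define u where "u j = (decay_weight a j - tail_weight a i j) / c" for j
  have u: "u \<in> weights"
    unfolding u_def
  proof (rule scaled_weights)
    show "(\<lambda>j. decay_weight a j - tail_weight a i j) sums c"
      unfolding c_def by (intro sums_diff decay_weight_sums tail_weight_sums a)
  qed (use c decay_weight_pos[OF a] decay_weight_weights in \<open>auto simp: tail_weight_def less_imp_le\<close>)
  have noise: "noise \<in> even_densities" "fejer_mixture u \<in> even_densities"
    by (auto intro: fejer_mixture_even_density u decay_weight_weights)
  have sig: "signal g \<in> even_densities" "signal (2 * g) \<in> even_densities"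
    using g by (auto intro: signal_even_density)
  have high: "cos_transform (fejer_mixture u) t = 0" if "real i \<le> \<bar>t\<bar>" for t
  proof (rule sums_unique2[OF cos_transform_fejer_mixture_sums[OF u]])
    have zero: "u j * tent (real j + 1) t = 0" for j
    proof (cases "j < i")
      case True
      then have "real j + 1 \<le> \<bar>t\<bar>" using that by linarith
      then show ?thesis by (simp add: tent_eq_0)
    qed (simp add: u_def tail_weight_def)
    show "(\<lambda>j. u j * tent (real j + 1) t) sums 0" unfolding zero by (rule sums_zero)
  qed
  have sep: "tent l (t - k) + tent l (t + k) = 0 \<or> real i \<le> \<bar>t\<bar>" for t
    using l tent_eq_0[of l "t - k"] tent_eq_0[of l "t + k"] by (auto simp: k_def abs_if split: if_splits)
  have same: "(law (signal (2 * g)) \<star> law (fejer_mixture u)) = (law (signal g) \<star> law (fejer_mixture u))"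
  proof (rule convolution_law_eqI[OF sig(2) noise(2) sig(1) noise(2)])
    fix t
    show "cos_transform (signal (2 * g)) t * cos_transform (fejer_mixture u) t = cos_transform (signal g) t * cos_transform (fejer_mixture u) t"
      using sep[of t] high[of t] l by (auto simp: cos_transform_modulated_fejer)
  qed
  have "dominates c (law noise) (law (fejer_mixture u))"
  proof (rule dominates_fejer_mixture[OF u decay_weight_weights])
    show "c * u j \<le> decay_weight a j" for j
      using c decay_weight_pos[OF a, of j] by (simp add: u_def tail_weight_def)
  qed (use c in simp)
  then have dom: "dominates c (law (signal h) \<star> law noise) (law (signal h) \<star> law (fejer_mixture u))"
    if "signal h \<in> even_densities" for h
    using c that noise by (intro dominates_convolution real_distribution_law) auto
  show ?thesis
  proof (rule maximal_risk_ge[OF T])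
    show "noise \<in> supersmooth a" by (intro fejer_mixture_supersmooth decay_weight_comparable a)
    then show "noise \<in> supersmooth a" .
    show "dominates c (law (signal g) \<star> law noise) (law (signal g) \<star> law (fejer_mixture u))"
      "dominates c (law (signal (2 * g)) \<star> law noise) (law (signal g) \<star> law (fejer_mixture u))"
      using dom[OF sig(1)] dom[OF sig(2)] same by simp_all
    show "dominates 1 (law noise) (law noise)" "dominates 1 (law noise) (law noise)" by (rule dominates_refl)+
    show "1 / 2 \<le> c ^ n * 1 ^ m" using one_minus_decay_power[OF n] by (simp add: c_def)
  qed (use c in \<open>auto intro!: noise sig real_distribution_convolution real_distribution_law\<close>)
qed

text \<open>
The pairs are (\<open>g\<close>, original noise) and (\<open>2 g\<close>, perturbed noise).  The product of the two characteristic
functions agrees near 0, where neither factor changes, and near \<open>\<plusminus> k\<close>, where one factor is doubled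
and the other halved; elsewhere the signals have no frequencies.
\<close>

lemma maximal_risk_ge_noise_sample:
  assumes T: "T \<in> estimators n m" and m: "decay a i \<le> 1 / (2 * real m)" "m \<ge> 1"
  shows "ennreal (l / (512 * pi) * (g\<^sup>2 * (1 + k\<^sup>2) powr s)) \<le>
    (SUP (fX, f\<epsilon>) \<in> {f \<in> L2_densities. cfun f \<in> sobolev_ball p \<rho>} \<times> supersmooth a. risk s n m T fX f\<epsilon>)"
proof -
  define c where "c = 1 - decay a i"
  have c: "c > 0" using decay_lt_1 by (simp add: c_def)
  define u where "u j = common_weight a i j / c" for j
  note cw = common_weight_bounds[OF a i small(1)]
  have u: "u \<in> weights"
    unfolding u_def
    by (rule scaled_weights[OF _ _ c _ decay_weight_weights]) (auto simp: c_def cw intro: common_weight_sums[OF a])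
  define noise' where "noise' = fejer_mixture (perturbed_weight a i)"
  have pw: "perturbed_weight a i \<in> comparable_weights a" "perturbed_weight a i \<in> weights"
    using perturbed_weight_comparable[OF a i small] comparable_weights_subset[OF a] by auto
  have noise: "noise \<in> even_densities" "noise' \<in> even_densities" "fejer_mixture u \<in> even_densities"
    unfolding noise'_def by (auto intro: fejer_mixture_even_density u decay_weight_weights pw)
  have sig: "signal g \<in> even_densities" "signal (2 * g) \<in> even_densities"
    using g by (auto intro: signal_even_density)
  have same: "(law (signal (2 * g)) \<star> law noise') = (law (signal g) \<star> law noise)"
  proof (rule convolution_law_eqI[OF sig(2) noise(2) sig(1) noise(1)])
    fix t
    consider "\<bar>t\<bar> \<le> 1" | "real i \<le> \<bar>t\<bar>" | "1 < \<bar>t\<bar>" "\<bar>t\<bar> < real i" by linarith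
    then show "cos_transform (signal (2 * g)) t * cos_transform noise' t = cos_transform (signal g) t * cos_transform noise t"
    proof cases
      case 1
      then have "tent l (t - k) = 0" "tent l (t + k) = 0" using l k_ge by (auto intro!: tent_eq_0)
      then show ?thesis
        using 1 l cos_transform_perturbed_low[OF a pw(2)] by (simp add: cos_transform_modulated_fejer noise'_def)
    next
      case 2
      then have "tent l t = 0" using l i by (intro tent_eq_0) auto
      then show ?thesis
        using 2 l cos_transform_perturbed_high[OF a pw(2) i] by (simp add: cos_transform_modulated_fejer noise'_def)
    next
      case 3
      then have "tent l (t - k) = 0" "tent l (t + k) = 0" "tent l t = 0"
        using l by (auto intro!: tent_eq_0 simp: k_def)
      then show ?thesis using l by (simp add: cos_transform_modulated_fejer)
    qed
  qed
  have "c * u j = common_weight a i j" for j using c by (simp add: u_def)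
  then have dom: "dominates c (law noise) (law (fejer_mixture u))" "dominates c (law noise') (law (fejer_mixture u))"
    unfolding noise'_def using c cw by (auto intro!: dominates_fejer_mixture u decay_weight_weights pw)
  show ?thesis
  proof (rule maximal_risk_ge[OF T])
    show "noise \<in> supersmooth a" by (intro fejer_mixture_supersmooth decay_weight_comparable a)
    show "noise' \<in> supersmooth a" unfolding noise'_def by (intro fejer_mixture_supersmooth pw a)
    show "dominates 1 (law (signal g) \<star> law noise) (law (signal g) \<star> law noise)"
      "dominates 1 (law (signal (2 * g)) \<star> law noise') (law (signal g) \<star> law noise)"
      unfolding same by (rule dominates_refl)+
    show "dominates c (law noise) (law (fejer_mixture u))" "dominates c (law noise') (law (fejer_mixture u))" by (rule dom)+
    show "1 / 2 \<le> 1 ^ n * c ^ m" using one_minus_decay_power[OF m] by (simp add: c_def)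
  qed (use c in \<open>auto intro!: noise sig real_distribution_convolution real_distribution_law\<close>)
qed

end

section \<open>The logarithmic rate\<close>

text \<open>
Any \<open>i\<close> with \<open>i powr (2 a) \<ge> 2 ln N\<close> is large enough, since \<open>ln (2 N) \<le> 2 ln N\<close>; rounding up and the lower
bound \<open>i0\<close> are absorbed into \<open>c\<close> because \<open>ln N \<ge> ln 2\<close>.
\<close>

lemma exists_frequency:
  assumes a: "a > 0"
  shows "\<exists>c>0. \<forall>N::nat. N \<ge> 2 \<longrightarrow>
    (\<exists>i\<ge>i0. decay a i \<le> 1 / (2 * real N) \<and> real i \<le> c * ln (real N) powr (1 / (2 * a)))"
proof -
  define b where "b = 1 / (2 * a)"
  define c where "c = (real i0 + 1) / ln 2 powr b + 2 powr b"
  have "c > 0" unfolding c_def by (intro add_nonneg_pos) auto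
  moreover have "\<exists>i\<ge>i0. decay a i \<le> 1 / (2 * real N) \<and> real i \<le> c * ln (real N) powr b" if N: "N \<ge> 2" for N :: nat
  proof -
    define x where "x = (2 * ln (real N)) powr b"
    define i where "i = i0 + nat \<lceil>x\<rceil>"
    have lnN: "ln 2 \<le> ln (real N)" using N by (intro ln_mono) auto
    have ln2: "0 < ln (2::real)" by simp
    have x: "0 \<le> x" by (simp add: x_def)
    have ix: "x \<le> real i" "real i \<le> real i0 + x + 1" unfolding i_def using x by linarith+
    have "ln (2 * real N) \<le> 2 * ln (real N)" using N lnN by (simp add: ln_mult)
    also have "\<dots> = x powr (2 * a)"
      using a order_trans[OF less_imp_le[OF ln2] lnN] by (simp add: x_def b_def powr_powr)
    also have "\<dots> \<le> real i powr (2 * a)" using a ix x by (intro powr_mono2) auto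
    finally have "decay a i \<le> exp (- ln (2 * real N))" by (simp add: decay_def)
    also have "\<dots> = 1 / (2 * real N)" using N by (simp add: exp_minus inverse_eq_divide)
    finally have "decay a i \<le> 1 / (2 * real N)" .
    moreover have "real i \<le> c * ln (real N) powr b"
    proof -
      have "ln 2 powr b \<le> ln (real N) powr b" using lnN ln2 a by (intro powr_mono2) (auto simp: b_def)
      then have le: "(real i0 + 1) / ln 2 powr b * ln 2 powr b \<le> (real i0 + 1) / ln 2 powr b * ln (real N) powr b"
        by (intro mult_left_mono) auto
      have eq: "(real i0 + 1) / ln 2 powr b * ln 2 powr b = real i0 + 1" by simp
      have "x = 2 powr b * ln (real N) powr b" using lnN ln2 by (simp add: x_def powr_mult)
      then show ?thesis unfolding c_def distrib_right using ix(2) le[unfolded eq] by linarith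
    qed
    ultimately show ?thesis by (intro exI[of _ i]) (simp add: i_def)
  qed
  ultimately show ?thesis unfolding b_def by blast
qed

text \<open>
The amplitude \<open>g\<close> exhausts the Sobolev ball, so \<open>g\<^sup>2 (1 + k\<^sup>2) powr s\<close> is of order \<open>k powr (- 2 (p - s))\<close>;
replacing \<open>i + 3/2\<close> by \<open>k = i + 1/2\<close> costs the factor \<open>4 powr (- p)\<close>.
\<close>

lemma separation_rate:
  fixes p s a c x :: real and i :: nat
  assumes "0 \<le> p" "s < p" "a > 0" "2 \<le> i" and c: "0 < c" and x: "0 < x" and ix: "real i \<le> c * x powr (1 / (2 * a))"
  defines "g \<equiv> (1 + (real i + 3 / 2)\<^sup>2) powr (- p / 2) / 2"
  shows "4 powr (- p) / 4 * (4 * c\<^sup>2) powr (- (p - s)) * x powr (- (p - s) / a)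
     \<le> g\<^sup>2 * (1 + (real i + 1 / 2)\<^sup>2) powr s"
proof -
  let ?k = "1 + (real i + 1 / 2)\<^sup>2"
  have i2: "2 \<le> real i" using assms by simp
  have k0: "0 < ?k" by (simp add: add_pos_nonneg)
  have "g\<^sup>2 = (1 + (real i + 3 / 2)\<^sup>2) powr (- p) / 4"
    unfolding g_def by (simp add: power_divide power2_eq_square powr_add[symmetric])
  also have "\<dots> \<ge> (4 * ?k) powr (- p) / 4"
  proof (intro divide_right_mono powr_mono2')
    show "1 + (real i + 3 / 2)\<^sup>2 \<le> 4 * ?k" using i2 by (simp add: power2_eq_square algebra_simps)
    show "0 < 1 + (real i + 3 / 2)\<^sup>2" by (simp add: add_pos_nonneg)
  qed (use assms in auto)
  finally have "(4 * ?k) powr (- p) / 4 \<le> g\<^sup>2" .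
  moreover have "(4 * ?k) powr (- p) = 4 powr (- p) * ?k powr (- p)" by (rule powr_mult)
  ultimately have g2: "4 powr (- p) * ?k powr (- p) / 4 \<le> g\<^sup>2" by (simp only:)
  have "?k \<le> 4 * (real i)\<^sup>2"
  proof -
    have "2 * real i \<le> (real i)\<^sup>2" using i2 by (simp add: power2_eq_square)
    moreover have "(real i + 1 / 2)\<^sup>2 = (real i)\<^sup>2 + real i + 1 / 4"
      by (simp add: power2_eq_square algebra_simps)
    ultimately show ?thesis using i2 by linarith
  qed
  also have "\<dots> \<le> 4 * (c * x powr (1 / (2 * a)))\<^sup>2" using ix by (intro mult_left_mono power_mono) auto
  also have "\<dots> = 4 * c\<^sup>2 * x powr (1 / a)" using x assms by (simp add: power_mult_distrib powr_power)
  finally have "(4 * c\<^sup>2 * x powr (1 / a)) powr (- (p - s)) \<le> ?k powr (- (p - s))"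
    using k0 assms by (intro powr_mono2') auto
  then have "(4 * c\<^sup>2) powr (- (p - s)) * x powr (- (p - s) / a) \<le> ?k powr (- (p - s))"
    using c x assms by (simp add: powr_mult powr_powr)
  then have "4 powr (- p) / 4 * ((4 * c\<^sup>2) powr (- (p - s)) * x powr (- (p - s) / a)) \<le> 4 powr (- p) / 4 * ?k powr (- (p - s))"
    by (intro mult_left_mono) auto
  also have "\<dots> = 4 powr (- p) * ?k powr (- p) / 4 * ?k powr s"
    by (simp add: powr_add[symmetric])
  also have "\<dots> \<le> g\<^sup>2 * ?k powr s" by (intro mult_right_mono g2) auto
  finally show ?thesis by (simp add: mult.assoc)
qed

theorem corollary4p9:
  fixes p s \<rho> a :: real
  assumes "p > 0" and "0 \<le> s" and "s < p" and "\<rho> > 0" and "a > 0"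
  shows "\<exists>C::real. C > 0 \<and> (\<forall>n m :: nat. n \<ge> 2 \<longrightarrow> m \<ge> 2 \<longrightarrow>
    (INF T \<in> estimators n m.
       SUP (fX, f\<epsilon>) \<in> {f \<in> L2_densities. cfun f \<in> sobolev_ball p \<rho>} \<times> supersmooth a.
         risk s n m T fX f\<epsilon>)
    \<ge> ennreal (C * (ln (real n) powr (- (p - s) / a) + ln (real m) powr (- (p - s) / a))))"
proof -
  have "eventually (\<lambda>i. decay a i < min (decay_weight a 0) (decay_weight a 1)) sequentially"
    using decay_weight_pos[OF \<open>a > 0\<close>] by (intro order_tendstoD(2)[OF decay_tendsto_0[OF \<open>a > 0\<close>]]) auto
  then obtain i1 where i1: "\<And>i. i \<ge> i1 \<Longrightarrow> decay a i < min (decay_weight a 0) (decay_weight a 1)"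
    by (auto simp: eventually_sequentially)
  obtain c where c: "c > 0" and
    freq: "\<And>N::nat. N \<ge> 2 \<Longrightarrow> \<exists>i\<ge>max 2 i1. decay a i \<le> 1 / (2 * real N) \<and> real i \<le> c * ln (real N) powr (1 / (2 * a))"
    using exists_frequency[OF \<open>a > 0\<close>, of "max 2 i1"] by blast
  define l where "l = min (1 / 4) (\<rho> / (2 * (2 powr p + 1)))"
  have pp: "2 * (2 powr p + 1) > 0" by (simp add: add_pos_pos)
  have l: "0 < l" "l \<le> 1 / 4" "2 * l * (2 powr p + 1) \<le> \<rho>"
  proof -
    show "0 < l" using \<open>\<rho> > 0\<close> pp by (auto simp: l_def)
    show "l \<le> 1 / 4" unfolding l_def by (rule min.cobounded1)
    have "l * (2 * (2 powr p + 1)) \<le> \<rho> / (2 * (2 powr p + 1)) * (2 * (2 powr p + 1))"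
      using pp by (intro mult_right_mono) (auto simp: l_def)
    then show "2 * l * (2 powr p + 1) \<le> \<rho>" using pp by (simp add: mult_ac)
  qed
  define C where "C = l / (512 * pi) * (4 powr (- p) / 4 * (4 * c\<^sup>2) powr (- (p - s)))"
  have C: "C > 0" using l c by (simp add: C_def)
  let ?R = "\<lambda>N::nat. ln (real N) powr (- (p - s) / a)"
  define g where "g i = (1 + (real i + 3 / 2)\<^sup>2) powr (- p / 2) / 2" for i :: nat
  have pair: "hypothesis_pair p s \<rho> a l (g i) i" if "i \<ge> max 2 i1" for i
  proof
    show "(2 * g i)\<^sup>2 * (1 + (real i + 3 / 2)\<^sup>2) powr p \<le> 1"
      by (simp add: g_def power2_eq_square powr_add[symmetric])
  qed (use assms l that i1[of i] in \<open>auto simp: g_def\<close>)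
  have rate: "C * ?R N \<le> l / (512 * pi) * ((g i)\<^sup>2 * (1 + (real i + 1 / 2)\<^sup>2) powr s)"
    if "i \<ge> max 2 i1" "N \<ge> 2" "real i \<le> c * ln (real N) powr (1 / (2 * a))" for i N
  proof -
    have "4 powr (- p) / 4 * (4 * c\<^sup>2) powr (- (p - s)) * ?R N \<le> (g i)\<^sup>2 * (1 + (real i + 1 / 2)\<^sup>2) powr s"
      unfolding g_def using assms that c by (intro separation_rate) auto
    then have "l / (512 * pi) * (4 powr (- p) / 4 * (4 * c\<^sup>2) powr (- (p - s)) * ?R N)
       \<le> l / (512 * pi) * ((g i)\<^sup>2 * (1 + (real i + 1 / 2)\<^sup>2) powr s)"
      using l by (intro mult_left_mono) auto
    then show ?thesis by (simp add: C_def mult_ac)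
  qed
  have "ennreal (C / 2 * (?R n + ?R m)) \<le> (INF T \<in> estimators n m.
       SUP (fX, f\<epsilon>) \<in> {f \<in> L2_densities. cfun f \<in> sobolev_ball p \<rho>} \<times> supersmooth a. risk s n m T fX f\<epsilon>)"
    if n: "n \<ge> 2" and m: "m \<ge> 2" for n m
  proof (rule INF_greatest)
    fix T assume T: "T \<in> estimators n m"
    let ?sup = "SUP (fX, f\<epsilon>) \<in> {f \<in> L2_densities. cfun f \<in> sobolev_ball p \<rho>} \<times> supersmooth a. risk s n m T fX f\<epsilon>"
    have bn: "ennreal (C * ?R n) \<le> ?sup"
    proof -
      obtain i where ix: "i \<ge> max 2 i1" "decay a i \<le> 1 / (2 * real n)" "real i \<le> c * ln (real n) powr (1 / (2 * a))"
        using freq[OF n] by blast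
      interpret hypothesis_pair p s \<rho> a l "g i" i by (rule pair) fact
      show ?thesis
        using maximal_risk_ge_Y_sample[OF T ix(2)] ennreal_leI[OF rate[OF ix(1) n ix(3)]] n
        by (simp add: k_def)
    qed
    have bm: "ennreal (C * ?R m) \<le> ?sup"
    proof -
      obtain i where ix: "i \<ge> max 2 i1" "decay a i \<le> 1 / (2 * real m)" "real i \<le> c * ln (real m) powr (1 / (2 * a))"
        using freq[OF m] by blast
      interpret hypothesis_pair p s \<rho> a l "g i" i by (rule pair) fact
      show ?thesis
        using maximal_risk_ge_noise_sample[OF T ix(2)] ennreal_leI[OF rate[OF ix(1) m ix(3)]] m
        by (simp add: k_def)
    qed
    have "C / 2 * (?R n + ?R m) \<le> max (C * ?R n) (C * ?R m)" by (simp add: algebra_simps max_def)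
    then have "ennreal (C / 2 * (?R n + ?R m)) \<le> ennreal (max (C * ?R n) (C * ?R m))" by (rule ennreal_leI)
    also have "\<dots> \<le> ?sup" using bn bm by (simp add: max_def)
    finally show "ennreal (C / 2 * (?R n + ?R m)) \<le> ?sup" .
  qed
  then show ?thesis using C by (intro exI[of _ "C / 2"]) auto
qed

end
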